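(* If $f\in\mathcal{E}(\mathcal{P}_{3,3}^+)$ is irreducible, then the zero locus $V_{\mathbb{C}}(f)\subset\mathbb{P}_{\mathbb{C}}^2$ is a rational curve with a unique singular point, and this singular point is either an acnode lying in the interior of $\mathbb{P}_+^2$, or a cusp lying on an edge of the triangle $\mathbb{P}_+^2$ and different from the vertices $(1:0:0)$, $(0:1:0)$, $(0:0:1)$.
   Context: $\mathcal{P}_{3,3}^+$ is the set of homogeneous polynomials $f\in\mathbb{R}[x,y,z]$ of degree $3$ (including $0$) with $f(x,y,z)\ge 0$ for all real $x,y,z\ge 0$. For a closed convex cone $\mathcal{P}$ containing no lines, a nonzero $f\in\mathcal{P}$ is extremal if $f=g+h$ with $g,h\in\mathcal{P}$ implies that $g$ and $h$ are scalar multiples of $f$; $\mathcal{E}(\mathcal{P})$ is the set of extremal elements of $\mathcal{P}$. $\mathbb{P}_+^2\subset\mathbb{P}_{\mathbb{R}}^2$ is the set of points having a representative with all coordinates $\ge0$; its interior consists of the points having a representative with all coordinates $>0$, and its edges are the subsets cut out by $x=0$, $y=0$, $z=0$. $V_{\mathbb{C}}(f)$ and $V_{\mathbb{R}}(f)$ denote the zero loci of $f$ in $\mathbb{P}_{\mathbb{C}}^2$ and $\mathbb{P}_{\mathbb{R}}^2$. An acnode of $V_{\mathbb{C}}(f)$ is a point $P\in\mathbb{P}^2_{\mathbb{R}}$ which is a simple node of $V_{\mathbb{C}}(f)$ (two analytic branches meeting transversally) and an isolated point of $V_{\mathbb{R}}(f)$; equivalently, a real node whose tangents are non-real complex conjugates.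 *)

theory Defs
  imports
    "HOL-Analysis.Analysis"
    "HOL-Library.Poly_Mapping"
    "HOL-Library.Numeral_Type"
    "HOL-Computational_Algebra.Factorial_Ring"
begin

section \<open>Polynomials in finitely many variables\<close>

text \<open>The finite type \<open>'n\<close> indexes the variables: the ring \<open>('n, 'a) mpoly\<close> is the monoid algebra
  of the monomials \<open>'n \<Rightarrow>\<^sub>0 nat\<close>, so that \<open>(3, real) mpoly\<close> is \<open>\<real>[x,y,z]\<close>.\<close>

type_synonym ('n, 'a) mpoly = "('n \<Rightarrow>\<^sub>0 nat) \<Rightarrow>\<^sub>0 'a"

definition poly_const :: "'a::zero \<Rightarrow> ('n, 'a) mpoly" where
  "poly_const c = Poly_Mapping.single 0 c"

definition poly_eval :: "('n::finite, 'a::comm_semiring_1) mpoly \<Rightarrow> 'a ^ 'n \<Rightarrow> 'a" where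
  "poly_eval p v =
     (\<Sum>m\<in>Poly_Mapping.keys p. Poly_Mapping.lookup p m * (\<Prod>i\<in>UNIV. (v $ i) ^ Poly_Mapping.lookup m i))"

text \<open>The zero polynomial is homogeneous of every degree.\<close>

definition homogeneous :: "nat \<Rightarrow> ('n::finite, 'a::zero) mpoly \<Rightarrow> bool" where
  "homogeneous d p \<longleftrightarrow> (\<forall>m\<in>Poly_Mapping.keys p. (\<Sum>i\<in>UNIV. Poly_Mapping.lookup m i) = d)"

text \<open>If the exponent of the \<open>i\<close>-th variable is 0, the truncated subtraction of exponents is
  harmless because the coefficient vanishes.\<close>

definition partial_deriv :: "'n \<Rightarrow> ('n, 'a::comm_semiring_1) mpoly \<Rightarrow> ('n, 'a) mpoly" where
  "partial_deriv i p =
     (\<Sum>m\<in>Poly_Mapping.keys p.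
        Poly_Mapping.single (m - Poly_Mapping.single i 1)
          (of_nat (Poly_Mapping.lookup m i) * Poly_Mapping.lookup p m))"

definition complexify :: "('n, real) mpoly \<Rightarrow> ('n, complex) mpoly" where
  "complexify p = Poly_Mapping.map complex_of_real p"


section \<open>The cone of copositive ternary cubics and its extremal elements\<close>

definition P33_plus :: "(3, real) mpoly set" where
  "P33_plus = {f. homogeneous 3 f \<and> (\<forall>v. (\<forall>i. v $ i \<ge> 0) \<longrightarrow> poly_eval f v \<ge> 0)}"

definition extremal :: "('n, real) mpoly set \<Rightarrow> ('n, real) mpoly set" where
  "extremal C = {f \<in> C. f \<noteq> 0 \<and>
     (\<forall>g\<in>C. \<forall>h\<in>C. f = g + h \<longrightarrow>
        (\<exists>a. g = poly_const a * f) \<and> (\<exists>b. h = poly_const b * f))}"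


section \<open>Projective space\<close>

text \<open>The projective space of \<open>'a ^ 'n\<close> has dimension \<open>CARD('n) - 1\<close>.  It is a quotient by a
  partial equivalence relation, with the nonzero vectors as domain; the map \<open>abs_proj\<close> sending a
  vector to its class is therefore only used on nonzero vectors.\<close>

definition proportional :: "('a::field) ^ 'n \<Rightarrow> 'a ^ 'n \<Rightarrow> bool" where
  "proportional v w \<longleftrightarrow> v \<noteq> 0 \<and> w \<noteq> 0 \<and> (\<exists>c. w = c *s v)"

quotient_type (overloaded) ('a, 'n) proj = "('a::field) ^ ('n::finite)" / partial: proportional
proof (rule part_equivpI)
  show "\<exists>v :: 'a ^ 'n. proportional v v"
    unfolding proportional_def
    by (rule exI[of _ "vec 1"]) (auto simp: vec_eq_iff intro: exI[of _ 1])
  show "symp (proportional :: 'a ^ 'n \<Rightarrow> 'a ^ 'n \<Rightarrow> bool)"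
  proof (rule sympI)
    fix v w :: "'a ^ 'n"
    assume "proportional v w"
    then obtain c where c: "v \<noteq> 0" "w \<noteq> 0" "w = c *s v"
      unfolding proportional_def by blast
    then have "c \<noteq> 0" by auto
    then have "v = inverse c *s w" using c by (simp add: vector_smult_assoc)
    then show "proportional w v" unfolding proportional_def using c by blast
  qed
  show "transp (proportional :: 'a ^ 'n \<Rightarrow> 'a ^ 'n \<Rightarrow> bool)"
    by (rule transpI) (auto simp: proportional_def vector_smult_assoc)
qed

text \<open>The quotient topology.\<close>

instantiation proj :: (real_normed_field, finite) topological_space
begin

definition open_proj :: "('a, 'b) proj set \<Rightarrow> bool" where
  "open_proj U \<longleftrightarrow> open {v. v \<noteq> 0 \<and> abs_proj v \<in> U}"

instance
proof
  have "{v :: 'a ^ 'b. v \<noteq> 0 \<and> abs_proj v \<in> UNIV} = - {0}" by auto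
  then show "open (UNIV :: ('a, 'b) proj set)"
    unfolding open_proj_def by (simp add: open_Compl)
next
  fix S T :: "('a, 'b) proj set"
  assume "open S" "open T"
  moreover have "{v. v \<noteq> 0 \<and> abs_proj v \<in> S \<inter> T}
      = {v. v \<noteq> 0 \<and> abs_proj v \<in> S} \<inter> {v. v \<noteq> 0 \<and> abs_proj v \<in> T}" by auto
  ultimately show "open (S \<inter> T)"
    unfolding open_proj_def by (simp add: open_Int)
next
  fix K :: "('a, 'b) proj set set"
  assume "\<forall>S\<in>K. open S"
  moreover have "{v. v \<noteq> 0 \<and> abs_proj v \<in> \<Union>K} = (\<Union>S\<in>K. {v. v \<noteq> 0 \<and> abs_proj v \<in> S})" by auto
  ultimately show "open (\<Union>K)"
    unfolding open_proj_def by auto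
qed

end

lift_definition complex_point :: "(real, 'n::finite) proj \<Rightarrow> (complex, 'n) proj"
  is "\<lambda>v. \<chi> i. complex_of_real (v $ i)"
  by (auto simp: proportional_def vec_eq_iff)

text \<open>Common zeros of a set of homogeneous polynomials.\<close>

definition proj_zeros :: "('n::finite, 'a::field) mpoly set \<Rightarrow> ('a, 'n) proj set" where
  "proj_zeros S = {abs_proj v | v. v \<noteq> 0 \<and> (\<forall>p\<in>S. poly_eval p v = 0)}"

definition V_real :: "('n::finite, real) mpoly \<Rightarrow> (real, 'n) proj set" where
  "V_real f = proj_zeros {f}"

definition V_complex :: "('n::finite, real) mpoly \<Rightarrow> (complex, 'n) proj set" where
  "V_complex f = proj_zeros {complexify f}"


section \<open>The triangle of points with nonnegative coordinates\<close>

definition P2_plus :: "(real, 3) proj set" where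
  "P2_plus = {abs_proj v | v. v \<noteq> 0 \<and> (\<forall>i. v $ i \<ge> 0)}"

definition P2_plus_interior :: "(real, 3) proj set" where
  "P2_plus_interior = {abs_proj v | v. \<forall>i. v $ i > 0}"

definition P2_plus_edge :: "3 \<Rightarrow> (real, 3) proj set" where
  "P2_plus_edge i = P2_plus \<inter> {abs_proj v | v. v \<noteq> 0 \<and> v $ i = 0}"

definition vertices :: "(real, 3) proj set" where
  "vertices = {abs_proj (axis i 1) | i. True}"


section \<open>Rational curves\<close>

definition zariski_closed :: "('a::field, 'n::finite) proj set \<Rightarrow> bool" where
  "zariski_closed Z \<longleftrightarrow> (\<exists>S. (\<forall>p\<in>S. \<exists>d. homogeneous d p) \<and> Z = proj_zeros S)"

definition irreducible_variety :: "('a::field, 'n::finite) proj set \<Rightarrow> bool" where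
  "irreducible_variety X \<longleftrightarrow> zariski_closed X \<and> X \<noteq> {} \<and>
     (\<forall>A B. zariski_closed A \<longrightarrow> zariski_closed B \<longrightarrow> X = A \<union> B \<longrightarrow> X = A \<or> X = B)"

definition nonempty_zariski_open_in :: "('a::field, 'n::finite) proj set \<Rightarrow> ('a, 'n) proj set \<Rightarrow> bool" where
  "nonempty_zariski_open_in X U \<longleftrightarrow> U \<noteq> {} \<and> (\<exists>Z. zariski_closed Z \<and> U = X - Z)"

definition eval_tuple :: "('m::finite \<Rightarrow> ('n::finite, 'a::comm_semiring_1) mpoly) \<Rightarrow> 'a ^ 'n \<Rightarrow> 'a ^ 'm" where
  "eval_tuple F v = (\<chi> i. poly_eval (F i) v)"

text \<open>The tuple \<open>F\<close> of forms of the same degree defines a map from \<open>U\<close> to \<open>W\<close>.\<close>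

definition forms_map :: "('m::finite \<Rightarrow> ('n::finite, 'a::field) mpoly) \<Rightarrow>
    ('a, 'n) proj set \<Rightarrow> ('a, 'm) proj set \<Rightarrow> bool" where
  "forms_map F U W \<longleftrightarrow> (\<exists>d. \<forall>i. homogeneous d (F i)) \<and>
     (\<forall>v. v \<noteq> 0 \<longrightarrow> abs_proj v \<in> U \<longrightarrow> eval_tuple F v \<noteq> 0 \<and> abs_proj (eval_tuple F v) \<in> W)"

text \<open>A rational map between irreducible projective varieties is given, on some nonempty open
  subset, by a tuple of forms of the same degree.  Two varieties are birational if such maps are
  mutually inverse on suitable nonempty open subsets.\<close>

definition birational :: "('a::field, 'n::finite) proj set \<Rightarrow> ('a, 'm::finite) proj set \<Rightarrow> bool" where
  "birational X Y \<longleftrightarrow>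
     (\<exists>U W F G. nonempty_zariski_open_in X U \<and> nonempty_zariski_open_in Y W \<and>
        forms_map F U W \<and> forms_map G W U \<and>
        (\<forall>v. v \<noteq> 0 \<longrightarrow> abs_proj v \<in> U \<longrightarrow> abs_proj (eval_tuple G (eval_tuple F v)) = abs_proj v) \<and>
        (\<forall>w. w \<noteq> 0 \<longrightarrow> abs_proj w \<in> W \<longrightarrow> abs_proj (eval_tuple F (eval_tuple G w)) = abs_proj w))"

definition rational_curve :: "(complex, 'n::finite) proj set \<Rightarrow> bool" where
  "rational_curve C \<longleftrightarrow> irreducible_variety C \<and> birational C (UNIV :: (complex, 2) proj set)"


section \<open>Singular points, nodes, acnodes and cusps\<close>

text \<open>For a hypersurface whose equation \<open>F\<close> is square-free (in particular if it is irreducible).\<close>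

definition singular_points :: "('n::finite, 'a::field) mpoly \<Rightarrow> ('a, 'n) proj set" where
  "singular_points F = {abs_proj v | v. v \<noteq> 0 \<and> poly_eval F v = 0 \<and>
     (\<forall>i. poly_eval (partial_deriv i F) v = 0)}"

text \<open>Holomorphic functions of two variables, by complex differentiability on an open set.\<close>

definition holomorphic2_on :: "(complex \<times> complex \<Rightarrow> complex) \<Rightarrow> (complex \<times> complex) set \<Rightarrow> bool" where
  "holomorphic2_on g U \<longleftrightarrow>
     (\<forall>x\<in>U. \<exists>a b. (g has_derivative (\<lambda>(s, t). a * s + b * t)) (at x))"

text \<open>\<open>X\<close> and \<open>Y\<close> form a system of local analytic coordinates at the origin.\<close>

definition local_coordinates ::
    "(complex \<times> complex \<Rightarrow> complex) \<Rightarrow> (complex \<times> complex \<Rightarrow> complex) \<Rightarrow> bool" where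
  "local_coordinates X Y \<longleftrightarrow>
     (\<exists>U. open U \<and> 0 \<in> U \<and> holomorphic2_on X U \<and> holomorphic2_on Y U) \<and> X 0 = 0 \<and> Y 0 = 0 \<and>
     (\<exists>a b c d. (X has_derivative (\<lambda>(s, t). a * s + b * t)) (at 0) \<and>
                (Y has_derivative (\<lambda>(s, t). c * s + d * t)) (at 0) \<and> a * d - b * c \<noteq> 0)"

text \<open>\<open>g\<close> is the equation of the curve \<open>F = 0\<close> in affine coordinates \<open>s, t\<close> centred at \<open>P\<close>: if
  \<open>v, a, b\<close> is a basis with \<open>v\<close> representing \<open>P\<close>, then \<open>(s, t) \<mapsto> v + s a + t b\<close> parametrizes the
  complement of a line.\<close>

definition affine_equation ::
    "(3, complex) mpoly \<Rightarrow> (complex, 3) proj \<Rightarrow> (complex \<times> complex \<Rightarrow> complex) \<Rightarrow> bool" where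
  "affine_equation F P g \<longleftrightarrow>
     (\<exists>v a b :: complex ^ 3. P = abs_proj v \<and> det (vector [v, a, b]) \<noteq> 0 \<and>
        g = (\<lambda>(s, t). poly_eval F (v + s *s a + t *s b)))"

text \<open>Two analytic branches \<open>X = 0\<close> and \<open>Y = 0\<close> meeting transversally.\<close>

definition node :: "(3, complex) mpoly \<Rightarrow> (complex, 3) proj \<Rightarrow> bool" where
  "node F P \<longleftrightarrow> (\<exists>g X Y. affine_equation F P g \<and> local_coordinates X Y \<and>
     (\<forall>\<^sub>F x in nhds 0. g x = X x * Y x))"

text \<open>Analytically equivalent to \<open>y\<^sup>2 = x\<^sup>3\<close>; a unit factor can be absorbed into the coordinates.\<close>

definition cusp :: "(3, complex) mpoly \<Rightarrow> (complex, 3) proj \<Rightarrow> bool" where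
  "cusp F P \<longleftrightarrow> (\<exists>g X Y. affine_equation F P g \<and> local_coordinates X Y \<and>
     (\<forall>\<^sub>F x in nhds 0. g x = (Y x)\<^sup>2 - (X x) ^ 3))"

definition acnode :: "(3, real) mpoly \<Rightarrow> (real, 3) proj \<Rightarrow> bool" where
  "acnode f P \<longleftrightarrow> node (complexify f) (complex_point P) \<and> P isolated_in (V_real f)"

end

theory Submission
  imports Defs
begin

text \<open>
  Write \<open>f(v) = T(v, v, v)\<close> with a symmetric trilinear form \<open>T\<close>.  Two independent facts combine.

  The first is algebraic.  Let \<open>P\<close> be a singular point.  In coordinates based at \<open>P\<close> the cubic is
  \<open>y q(s, z) + k(s, z)\<close> with binary forms \<open>q\<close>, \<open>k\<close> of degrees 2 and 3.  A common complex zero of \<open>q\<close>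
  and \<open>k\<close> would give \<open>f\<close> a real linear factor, so there is none (\<open>no_common_zero\<close>).  Therefore \<open>P\<close> is the
  only singular point (\<open>singular_point_unique\<close>), and the lines through \<open>P\<close> parametrize the curve by
  \<open>(- k : q s : q z)\<close> (\<open>rational_curve_V\<close>).  If \<open>q\<close> is definite, \<open>P\<close> is an acnode (\<open>acnode_P\<close>); if
  \<open>q\<close> is nonzero, semidefinite and degenerate, then \<open>k\<close> does not vanish on the null line of \<open>q\<close>, and \<open>P\<close>
  is a cusp (\<open>cusp_P\<close>).

  The second comes from extremality: \<open>f\<close> cannot dominate, on the orthant, a copositive form that is a
  product of forms of lower degree, since subtracting a small multiple of it would decompose \<open>f\<close>
  (\<open>extremal_no_minorant\<close>).  By compactness, domination may be tested near each zero of \<open>f\<close>, and near a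
  smooth zero \<open>f\<close> grows at least linearly in one of the vanishing coordinates (\<open>linear_growth\<close>).
  This excludes everything but the two cases of the theorem.  If no zero in the triangle is
  singular, \<open>f\<close> dominates \<open>x y z\<close> (\<open>singular_zero_exists\<close>).  If \<open>f\<close> is singular at a vertex, it
  dominates \<open>x q\<close> (\<open>vertex_not_singular\<close>).  If it has an acnode in the interior of an edge, it dominates
  a coordinate times the square of a linear form (\<open>no_acnode_on_edge\<close>).

  So there is a singular zero \<open>P\<close>, not a vertex, and \<open>q\<close> is semidefinite because \<open>f\<close> has a minimum
  at \<open>P\<close>.  If \<open>P\<close> is an interior point, \<open>f\<close> restricted to the line in a null direction \<open>w\<close> of \<open>q\<close> is
  \<open>k(w)\<close> times a cube, so \<open>k(w) = 0\<close>, which is impossible; \<open>q\<close> is definite.  If \<open>P\<close> lies on an edge,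
  the same argument shows that \<open>q\<close> is positive in the direction of the edge, and \<open>q\<close> is not definite.
\<close>

section \<open>Evaluation of polynomials\<close>

definition monom_eval :: "('n::finite \<Rightarrow>\<^sub>0 nat) \<Rightarrow> 'a::comm_semiring_1 ^ 'n \<Rightarrow> 'a" where
  "monom_eval m v = (\<Prod>i\<in>UNIV. (v $ i) ^ Poly_Mapping.lookup m i)"

lemma monom_eval_add: "monom_eval (m + n) v = monom_eval m v * monom_eval n v"
  by (simp add: monom_eval_def lookup_add power_add prod.distrib)

lemma poly_eval_monom_eval:
  "poly_eval p v = (\<Sum>m\<in>Poly_Mapping.keys p. Poly_Mapping.lookup p m * monom_eval m v)"
  by (simp add: poly_eval_def monom_eval_def)

lemma poly_eval_superset:
  assumes "finite A" "Poly_Mapping.keys p \<subseteq> A"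
  shows "poly_eval p v = (\<Sum>m\<in>A. Poly_Mapping.lookup p m * monom_eval m v)"
  unfolding poly_eval_monom_eval
  by (rule sum.mono_neutral_left) (use assms in \<open>auto simp: in_keys_iff\<close>)

lemma poly_eval_zero [simp]: "poly_eval 0 v = 0"
  by (simp add: poly_eval_def)

lemma poly_eval_add [simp]: "poly_eval (p + q) v = poly_eval p v + poly_eval q v"
proof -
  let ?A = "Poly_Mapping.keys p \<union> Poly_Mapping.keys q"
  have "poly_eval (p + q) v = (\<Sum>m\<in>?A. Poly_Mapping.lookup (p + q) m * monom_eval m v)"
    using keys_add[of p q] by (intro poly_eval_superset) auto
  then show ?thesis
    by (simp add: poly_eval_superset[of ?A p] poly_eval_superset[of ?A q] lookup_add
        distrib_right sum.distrib)
qed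

lemma poly_eval_sum [simp]: "poly_eval (sum p A) v = (\<Sum>x\<in>A. poly_eval (p x) v)"
  by (induction A rule: infinite_finite_induct) simp_all

lemma poly_eval_single [simp]: "poly_eval (Poly_Mapping.single m c) v = c * monom_eval m v"
  by (cases "c = 0") (simp_all add: poly_eval_monom_eval)

lemma sum_monomials:
  "p = (\<Sum>m\<in>Poly_Mapping.keys p. Poly_Mapping.single m (Poly_Mapping.lookup p m))"
  by (rule poly_mapping_eqI)
    (auto simp: lookup_sum lookup_single when_def in_keys_iff)

lemma poly_eval_mult [simp]: "poly_eval (p * q) v = poly_eval p v * poly_eval q v"
proof -
  have "p * q = (\<Sum>m\<in>Poly_Mapping.keys p. Poly_Mapping.single m (Poly_Mapping.lookup p m)) *
      (\<Sum>n\<in>Poly_Mapping.keys q. Poly_Mapping.single n (Poly_Mapping.lookup q n))"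
    using sum_monomials[of p] sum_monomials[of q] by simp
  also have "\<dots> = (\<Sum>m\<in>Poly_Mapping.keys p. \<Sum>n\<in>Poly_Mapping.keys q.
      Poly_Mapping.single (m + n) (Poly_Mapping.lookup p m * Poly_Mapping.lookup q n))"
    by (simp add: sum_product mult_single)
  finally show ?thesis
    by (simp add: poly_eval_monom_eval[of p] poly_eval_monom_eval[of q] sum_product
        monom_eval_add mult_ac)
qed

lemma poly_eval_const [simp]: "poly_eval (poly_const c) v = c"
  by (simp add: poly_const_def monom_eval_def)

lemma poly_eval_one [simp]: "poly_eval 1 v = 1"
  using poly_eval_const[of 1 v] by (simp add: poly_const_def)

lemma poly_eval_uminus [simp]:
  fixes p :: "('n::finite, 'a::comm_ring_1) mpoly"
  shows "poly_eval (- p) v = - poly_eval p v"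
  using poly_eval_add[of p "- p" v] by (simp add: eq_neg_iff_add_eq_0 add.commute)

lemma poly_eval_diff [simp]:
  fixes p :: "('n::finite, 'a::comm_ring_1) mpoly"
  shows "poly_eval (p - q) v = poly_eval p v - poly_eval q v"
  using poly_eval_add[of p "- q" v] by simp

definition poly_var :: "'n \<Rightarrow> ('n, 'a::comm_semiring_1) mpoly" where
  "poly_var i = Poly_Mapping.single (Poly_Mapping.single i 1) 1"

lemma poly_eval_var [simp]: "poly_eval (poly_var i) v = v $ i"
proof -
  have "(\<Prod>j\<in>UNIV. (v $ j) ^ (Poly_Mapping.lookup (Poly_Mapping.single i 1) j)) =
      (\<Prod>j\<in>UNIV. if j = i then v $ i else 1)"
    by (rule prod.cong) (auto simp: lookup_single when_def)
  then show ?thesis by (simp add: poly_var_def monom_eval_def)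
qed

lemma homogeneous_add [intro]: "homogeneous d p \<Longrightarrow> homogeneous d q \<Longrightarrow> homogeneous d (p + q)"
  using keys_add[of p q] by (auto simp: homogeneous_def)

lemma homogeneous_uminus [intro]:
  fixes p :: "('n::finite, 'a::ab_group_add) mpoly"
  shows "homogeneous d p \<Longrightarrow> homogeneous d (- p)"
  by (auto simp: homogeneous_def in_keys_iff)

lemma homogeneous_diff [intro]:
  fixes p :: "('n::finite, 'a::ab_group_add) mpoly"
  shows "homogeneous d p \<Longrightarrow> homogeneous d q \<Longrightarrow> homogeneous d (p - q)"
  using homogeneous_add[OF _ homogeneous_uminus, of d p q] by simp

lemma homogeneous_mult:
  fixes p q :: "('n::finite, 'a::comm_semiring_1) mpoly"
  assumes "homogeneous d p" "homogeneous e q" "n = d + e"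
  shows "homogeneous n (p * q)"
proof -
  have "(\<Sum>i\<in>UNIV. Poly_Mapping.lookup m i) = n" if m: "m \<in> Poly_Mapping.keys (p * q)" for m
  proof -
    obtain a b where "m = a + b" "a \<in> Poly_Mapping.keys p" "b \<in> Poly_Mapping.keys q"
      using subsetD[OF keys_mult m] by auto
    then show ?thesis
      using assms by (simp add: homogeneous_def lookup_add sum.distrib)
  qed
  then show ?thesis by (simp add: homogeneous_def)
qed

lemma homogeneous_const [simp]: "homogeneous 0 (poly_const c :: ('n::finite, 'a::zero) mpoly)"
  by (auto simp: homogeneous_def poly_const_def split: if_splits)

lemma homogeneous_var [simp]: "homogeneous (Suc 0) (poly_var i :: ('n::finite, 'a::comm_semiring_1) mpoly)"
  by (auto simp: homogeneous_def poly_var_def lookup_single when_def)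

lemma homogeneous_const_mult [intro]:
  fixes p :: "('n::finite, 'a::comm_semiring_1) mpoly"
  shows "homogeneous d p \<Longrightarrow> homogeneous d (poly_const c * p)"
  by (rule homogeneous_mult[OF homogeneous_const]) auto

lemma poly_eval_homogeneous:
  fixes v :: "'a::comm_semiring_1 ^ 'n::finite"
  assumes "homogeneous d p"
  shows "poly_eval p (c *s v) = c ^ d * poly_eval p v"
proof -
  have "monom_eval m (c *s v) = c ^ d * monom_eval m v" if "m \<in> Poly_Mapping.keys p" for m
  proof -
    have "monom_eval m (c *s v) = c ^ (\<Sum>i\<in>UNIV. Poly_Mapping.lookup m i) * monom_eval m v"
      by (simp add: monom_eval_def power_mult_distrib prod.distrib power_sum)
    then show ?thesis using assms that by (simp add: homogeneous_def)
  qed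
  then show ?thesis
    by (simp add: poly_eval_monom_eval sum_distrib_left mult_ac)
qed

text \<open>Kronecker substitution: at \<open>(u, u\<^sup>4, u\<^sup>1\<^sup>6)\<close> distinct cubic monomials become distinct powers
  of \<open>u\<close>.\<close>

lemma ternary_cubic_eqI:
  fixes p q :: "(3, real) mpoly"
  assumes p: "homogeneous 3 p" and q: "homogeneous 3 q"
    and eq: "\<And>v. poly_eval p v = poly_eval q v"
  shows "p = q"
proof -
  define r where "r = p - q"
  have r: "homogeneous 3 r" unfolding r_def using p q by blast
  define e where "e m = Poly_Mapping.lookup m 1 + 4 * Poly_Mapping.lookup m 2
    + 16 * Poly_Mapping.lookup m 3" for m :: "3 \<Rightarrow>\<^sub>0 nat"
  have digits: "a = (a + 4 * b + 16 * c) mod 4 \<and> b = ((a + 4 * b + 16 * c) div 4) mod 4"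
    if "a \<le> 3" "b \<le> 3" for a b c :: nat
  proof -
    have "a + 4 * b + 16 * c = a + 4 * (b + 4 * c)" by simp
    with that show ?thesis by (simp only: mod_mult_self2 div_mult_self2) auto
  qed
  have inj: "inj_on e (Poly_Mapping.keys r)"
  proof (rule inj_onI)
    fix m n assume mn: "m \<in> Poly_Mapping.keys r" "n \<in> Poly_Mapping.keys r" "e m = e n"
    have "Poly_Mapping.lookup m 1 + Poly_Mapping.lookup m 2 + Poly_Mapping.lookup m 3 = 3"
      "Poly_Mapping.lookup n 1 + Poly_Mapping.lookup n 2 + Poly_Mapping.lookup n 3 = 3"
      using r mn by (auto simp: homogeneous_def sum_3)
    then have le: "Poly_Mapping.lookup m 1 \<le> 3" "Poly_Mapping.lookup m 2 \<le> 3"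
      "Poly_Mapping.lookup n 1 \<le> 3" "Poly_Mapping.lookup n 2 \<le> 3"
      by linarith+
    have "Poly_Mapping.lookup m 1 = Poly_Mapping.lookup n 1"
      "Poly_Mapping.lookup m 2 = Poly_Mapping.lookup n 2"
      using digits[OF le(1,2), of "Poly_Mapping.lookup m 3"]
        digits[OF le(3,4), of "Poly_Mapping.lookup n 3"] mn(3)
      unfolding e_def by simp_all
    with mn(3) have "Poly_Mapping.lookup m 1 = Poly_Mapping.lookup n 1 \<and>
       Poly_Mapping.lookup m 2 = Poly_Mapping.lookup n 2 \<and>
       Poly_Mapping.lookup m 3 = Poly_Mapping.lookup n 3"
      unfolding e_def by simp
    then have "Poly_Mapping.lookup m x = Poly_Mapping.lookup n x" for x
      using exhaust_3[of x] by auto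
    then show "m = n" by (simp add: poly_mapping_eqI)
  qed
  define P where "P = (\<Sum>m\<in>Poly_Mapping.keys r. Polynomial.monom (Poly_Mapping.lookup r m) (e m))"
  have "poly P u = 0" for u
  proof -
    have "u ^ e m = monom_eval m (vector [u, u ^ 4, u ^ 16])" for m
      by (simp only: monom_eval_def UNIV_3 e_def power_add power_mult) simp
    then have "poly P u = poly_eval r (vector [u, u ^ 4, u ^ 16])"
      unfolding P_def poly_eval_monom_eval by (simp add: poly_sum poly_monom)
    then show ?thesis using eq by (simp add: r_def)
  qed
  then have "P = 0" using poly_all_0_iff_0 by blast
  have "Poly_Mapping.lookup r m = 0" if "m \<in> Poly_Mapping.keys r" for m
  proof -
    have "Polynomial.coeff P (e m) =
        (\<Sum>n\<in>Poly_Mapping.keys r. if n = m then Poly_Mapping.lookup r n else 0)"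
      unfolding P_def coeff_sum
      by (rule sum.cong) (use inj that in \<open>auto simp: inj_on_def\<close>)
    with that \<open>P = 0\<close> show ?thesis by simp
  qed
  then have "Poly_Mapping.lookup r m = Poly_Mapping.lookup 0 m" for m
    by (cases "m \<in> Poly_Mapping.keys r") (auto simp: in_keys_iff)
  then have "r = 0" by (rule poly_mapping_eqI)
  then show ?thesis by (simp add: r_def)
qed

lemma not_irreducible_product:
  fixes f a b :: "('n::finite, real) mpoly"
  assumes "irreducible f" "f = a * b" "poly_eval a 0 = 0" "poly_eval b 0 = 0"
  shows False
proof -
  have "a dvd 1 \<or> b dvd 1" using assms by (auto simp: irreducible_def)
  then obtain c where "1 = a * c \<or> 1 = b * c" unfolding dvd_def by blast
  then have "poly_eval 1 (0 :: real ^ 'n) = poly_eval a 0 * poly_eval c 0 \<or>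
    poly_eval 1 (0 :: real ^ 'n) = poly_eval b 0 * poly_eval c 0"
    by (metis poly_eval_mult)
  then show False using assms by simp
qed


section \<open>Ternary cubics as symmetric trilinear forms\<close>

text \<open>Polarization makes changes of coordinates, complexification and derivatives of a cubic
  transparent: all of them are read off from one real symmetric tensor.\<close>

definition tri :: "(3 \<Rightarrow> 3 \<Rightarrow> 3 \<Rightarrow> 'a) \<Rightarrow> 'a ^ 3 \<Rightarrow> 'a ^ 3 \<Rightarrow> 'a ^ 3 \<Rightarrow> 'a::comm_ring_1" where
  "tri t a b c = (\<Sum>i\<in>UNIV. \<Sum>j\<in>UNIV. \<Sum>k\<in>UNIV. t i j k * a $ i * b $ j * c $ k)"

definition sym3 :: "(3 \<Rightarrow> 3 \<Rightarrow> 3 \<Rightarrow> 'a) \<Rightarrow> bool" where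
  "sym3 t \<longleftrightarrow> (\<forall>i j k. t i j k = t j i k \<and> t i j k = t i k j)"

lemma tri_add:
  "tri t (a + a') b c = tri t a b c + tri t a' b c"
  "tri t a (b + b') c = tri t a b c + tri t a b' c"
  "tri t a b (c + c') = tri t a b c + tri t a b c'"
  by (simp_all add: tri_def algebra_simps sum.distrib)

lemma tri_scale:
  "tri t (r *s a) b c = r * tri t a b c"
  "tri t a (r *s b) c = r * tri t a b c"
  "tri t a b (r *s c) = r * tri t a b c"
  by (simp_all add: tri_def sum_distrib_left mult_ac)

lemma tri_uminus:
  "tri t (- a) b c = - tri t a b c"
  "tri t a (- b) c = - tri t a b c"
  "tri t a b (- c) = - tri t a b c"
  by (simp_all add: tri_def sum_negf)

lemma tri_zero [simp]: "tri t 0 b c = 0" "tri t a 0 c = 0" "tri t a b 0 = 0"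
  by (simp_all add: tri_def)

lemma tri_swap:
  assumes "sym3 t"
  shows "tri t a b c = tri t b a c" "tri t a b c = tri t a c b"
proof -
  have "tri t a b c = (\<Sum>j\<in>UNIV. \<Sum>i\<in>UNIV. \<Sum>k\<in>UNIV. t i j k * a $ i * b $ j * c $ k)"
    unfolding tri_def by (rule sum.swap)
  also have "\<dots> = tri t b a c" unfolding tri_def
    using assms by (intro sum.cong refl) (simp add: sym3_def mult_ac)
  finally show "tri t a b c = tri t b a c" .
  have "tri t a b c = (\<Sum>i\<in>UNIV. \<Sum>k\<in>UNIV. \<Sum>j\<in>UNIV. t i j k * a $ i * b $ j * c $ k)"
    unfolding tri_def by (intro sum.cong refl sum.swap)
  also have "\<dots> = tri t a c b" unfolding tri_def
    using assms by (intro sum.cong refl) (simp add: sym3_def mult_ac)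
  finally show "tri t a b c = tri t a c b" .
qed

lemma tri_swap': "sym3 t \<Longrightarrow> tri t a b c = tri t c b a"
  by (metis tri_swap)

text \<open>The three transpositions serve as ordered rewrite rules.\<close>

lemmas tri_ac = tri_swap tri_swap'

lemma tri_expand:
  assumes "sym3 t"
  shows "tri t (x *s p + y *s a + z *s b) (x *s p + y *s a + z *s b) (x *s p + y *s a + z *s b) =
    x ^ 3 * tri t p p p + 3 * x\<^sup>2 * (y * tri t p p a + z * tri t p p b) +
    x * (3 * tri t p a a * y\<^sup>2 + 6 * tri t p a b * y * z + 3 * tri t p b b * z\<^sup>2) +
    (tri t a a a * y ^ 3 + 3 * tri t a a b * y\<^sup>2 * z + 3 * tri t a b b * y * z\<^sup>2 + tri t b b b * z ^ 3)"
  by (simp add: tri_add tri_scale tri_ac[OF assms] power2_eq_square power3_eq_cube algebra_simps)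

lemma tri_polar:
  assumes "sym3 t"
  shows "tri t p (y *s p + s *s a + z *s b) (y *s p + s *s a + z *s b) =
    y\<^sup>2 * tri t p p p + 2 * y * (s * tri t p p a + z * tri t p p b) +
    tri t p a a * s\<^sup>2 + 2 * tri t p a b * s * z + tri t p b b * z\<^sup>2"
  by (simp add: tri_add tri_scale tri_ac[OF assms] power2_eq_square algebra_simps)

lemma tri_eq_0_if_axis:
  assumes "\<And>l. tri t a b (axis l 1) = 0"
  shows "tri t a b w = 0"
proof -
  have "w = w $ 1 *s axis 1 1 + w $ 2 *s axis 2 1 + w $ 3 *s axis 3 1"
    unfolding vec_eq_iff forall_3 by (simp add: axis_def)
  from arg_cong[OF this, of "tri t a b"] show ?thesis
    by (simp add: tri_add tri_scale assms)
qed

definition cvec :: "real ^ 'n \<Rightarrow> complex ^ 'n" where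
  "cvec v = (\<chi> i. complex_of_real (v $ i))"

lemma cvec_nth [simp]: "cvec v $ i = complex_of_real (v $ i)"
  by (simp add: cvec_def)

lemma cvec_add: "cvec (v + w) = cvec v + cvec w"
  and cvec_scale: "cvec (c *s v) = complex_of_real c *s cvec v"
  by (simp_all add: vec_eq_iff)

lemma cvec_axis: "cvec (axis i 1) = axis i 1"
  by (simp add: vec_eq_iff axis_def)

lemma cvec_eq_0_iff [simp]: "cvec v = 0 \<longleftrightarrow> v = 0"
  by (simp add: vec_eq_iff)

abbreviation ctri :: "(3 \<Rightarrow> 3 \<Rightarrow> 3 \<Rightarrow> real) \<Rightarrow> complex ^ 3 \<Rightarrow> complex ^ 3 \<Rightarrow> complex ^ 3 \<Rightarrow> complex" where
  "ctri t \<equiv> tri (\<lambda>i j k. complex_of_real (t i j k))"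

lemma ctri_cvec: "ctri t (cvec a) (cvec b) (cvec c) = complex_of_real (tri t a b c)"
  by (simp add: tri_def)

lemma sym3_of_real: "sym3 t \<Longrightarrow> sym3 (\<lambda>i j k. complex_of_real (t i j k))"
  by (simp add: sym3_def)

lemma keys_complexify: "Poly_Mapping.keys (complexify f) = Poly_Mapping.keys f"
  by (auto simp: complexify_def in_keys_iff map.rep_eq when_def)

lemma lookup_complexify:
  "Poly_Mapping.lookup (complexify f) m = complex_of_real (Poly_Mapping.lookup f m)"
  by (auto simp: complexify_def map.rep_eq when_def)

lemma homogeneous_complexify: "homogeneous d f \<Longrightarrow> homogeneous d (complexify f)"
  by (simp add: homogeneous_def keys_complexify)

lemma poly_eval_complexify_cvec:
  "poly_eval (complexify f) (cvec v) = complex_of_real (poly_eval f v)"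
  by (simp add: poly_eval_def keys_complexify lookup_complexify)

lemma partial_deriv_has_derivative:
  fixes p :: "('n::finite, complex) mpoly"
  shows "((\<lambda>e. poly_eval p (v + e *s axis l 1)) has_field_derivative
    poly_eval (partial_deriv l p) v) (at 0)"
proof -
  have single: "((\<lambda>e. monom_eval m (v + e *s axis l 1)) has_field_derivative
      of_nat (Poly_Mapping.lookup m l) * monom_eval (m - Poly_Mapping.single l 1) v) (at 0)" for m
  proof -
    let ?c = "\<Prod>i\<in>UNIV - {l}. v $ i ^ Poly_Mapping.lookup m i"
    have "monom_eval m (v + e *s axis l 1) = (v $ l + e) ^ Poly_Mapping.lookup m l * ?c" for e
      unfolding monom_eval_def
      by (subst prod.remove[of _ l]) (auto simp: axis_def intro!: prod.cong)
    moreover have "monom_eval (m - Poly_Mapping.single l 1) v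
        = v $ l ^ (Poly_Mapping.lookup m l - 1) * ?c"
      unfolding monom_eval_def
      by (subst prod.remove[of _ l])
        (auto simp: lookup_minus lookup_single when_def intro!: prod.cong)
    ultimately show ?thesis
      by (auto intro!: derivative_eq_intros)
  qed
  have "((\<lambda>e. \<Sum>m\<in>Poly_Mapping.keys p. Poly_Mapping.lookup p m * monom_eval m (v + e *s axis l 1))
    has_field_derivative (\<Sum>m\<in>Poly_Mapping.keys p. Poly_Mapping.lookup p m *
      (of_nat (Poly_Mapping.lookup m l) * monom_eval (m - Poly_Mapping.single l 1) v))) (at 0)"
    by (intro DERIV_sum DERIV_cmult single)
  then show ?thesis
    by (simp add: poly_eval_monom_eval[of p] partial_deriv_def mult_ac)
qed

lemma degree_3_monomial:
  fixes m :: "3 \<Rightarrow>\<^sub>0 nat"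
  assumes "(\<Sum>i\<in>UNIV. Poly_Mapping.lookup m i) = 3"
  obtains i j k where "m = Poly_Mapping.single i 1 + Poly_Mapping.single j 1 + Poly_Mapping.single k 1"
proof -
  have step: "\<exists>i n. m = n + Poly_Mapping.single i 1 \<and> (\<Sum>i\<in>UNIV. Poly_Mapping.lookup n i) = d"
    if m: "(\<Sum>i\<in>UNIV. Poly_Mapping.lookup m i) = Suc d" for m :: "3 \<Rightarrow>\<^sub>0 nat" and d
  proof -
    obtain i where "Poly_Mapping.lookup m i > 0"
      using m by (metis sum.neutral bot_nat_0.not_eq_extremum nat.distinct(1))
    then have *: "m = (m - Poly_Mapping.single i 1) + Poly_Mapping.single i 1"
      by (intro poly_mapping_eqI) (auto simp: lookup_add lookup_minus lookup_single when_def)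
    then have "Suc d = (\<Sum>x\<in>UNIV. Poly_Mapping.lookup (m - Poly_Mapping.single i 1) x) +
        (\<Sum>x\<in>UNIV. Poly_Mapping.lookup (Poly_Mapping.single i 1) x)"
      using m by (metis (no_types, lifting) lookup_add sum.cong sum.distrib)
    then show ?thesis using * by (auto simp: lookup_single when_def)
  qed
  from step[of m 2] assms obtain k n where n: "m = n + Poly_Mapping.single k 1"
    "(\<Sum>i\<in>UNIV. Poly_Mapping.lookup n i) = 2" by auto
  from step[of n 1] n obtain j n' where n': "n = n' + Poly_Mapping.single j 1"
    "(\<Sum>i\<in>UNIV. Poly_Mapping.lookup n' i) = 1" by auto
  from step[of n' 0] n' obtain i n'' where n'': "n' = n'' + Poly_Mapping.single i 1"
    "(\<Sum>i\<in>UNIV. Poly_Mapping.lookup n'' i) = 0" by auto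
  have "n'' = 0" by (rule poly_mapping_eqI) (use n'' in auto)
  with n n' n'' that show ?thesis by simp
qed

lemma symmetrize:
  fixes t :: "3 \<Rightarrow> 3 \<Rightarrow> 3 \<Rightarrow> real"
  obtains s where "sym3 s" "\<And>v. ctri s v v v = ctri t v v v"
proof
  let ?s = "\<lambda>i j k. (t i j k + t i k j + t j i k + t j k i + t k i j + t k j i) / 6"
  show "sym3 ?s" by (simp add: sym3_def)
  show "ctri ?s v v v = ctri t v v v" for v
    by (simp add: tri_def sum_3) (simp add: field_simps)
qed

lemma homogeneous_3_tri:
  fixes f :: "(3, real) mpoly"
  assumes "homogeneous 3 f"
  obtains t where "sym3 t" "\<And>v. poly_eval (complexify f) v = ctri t v v v"
proof -
  have mono: "\<exists>t. \<forall>v. monom_eval m v = ctri t v v v"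
    if deg: "(\<Sum>i\<in>UNIV. Poly_Mapping.lookup m i) = 3" for m
  proof -
    obtain i j k where m: "m = Poly_Mapping.single i 1 + Poly_Mapping.single j 1 + Poly_Mapping.single k 1"
      using degree_3_monomial[OF deg] by blast
    have var: "monom_eval (Poly_Mapping.single l (Suc 0)) v = v $ l" for l and v :: "complex ^ 3"
      using poly_eval_var[of l v] by (simp add: poly_var_def)
    have "monom_eval m v = ctri (\<lambda>i' j' k'. if i' = i then if j' = j then if k' = k then 1 else 0 else 0 else 0) v v v"
      for v :: "complex ^ 3"
      using exhaust_3[of i] exhaust_3[of j] exhaust_3[of k]
      by (auto simp: m monom_eval_add var tri_def sum_3)
    then show ?thesis by (intro exI allI)
  qed
  have "\<exists>T. \<forall>m\<in>Poly_Mapping.keys f. \<forall>v. monom_eval m v = ctri (T m) v v v"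
    by (rule bchoice) (use mono assms in \<open>auto simp: homogeneous_def\<close>)
  then obtain T where T: "\<And>m v. m \<in> Poly_Mapping.keys f \<Longrightarrow> monom_eval m v = ctri (T m) v v v"
    by blast
  let ?t = "\<lambda>i j k. \<Sum>m\<in>Poly_Mapping.keys f. Poly_Mapping.lookup f m * T m i j k"
  have "poly_eval (complexify f) v = ctri ?t v v v" for v
  proof -
    have "poly_eval (complexify f) v =
      (\<Sum>m\<in>Poly_Mapping.keys f. complex_of_real (Poly_Mapping.lookup f m) * ctri (T m) v v v)"
      by (simp add: poly_eval_monom_eval keys_complexify lookup_complexify T)
    also have "\<dots> = ctri ?t v v v"
      by (simp add: tri_def sum_3 sum.distrib sum_distrib_left sum_distrib_right algebra_simps)
    finally show ?thesis .
  qed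
  with symmetrize[of ?t] that show ?thesis by metis
qed

lemma poly_eval_tri:
  assumes "\<And>v. poly_eval (complexify f) v = ctri t v v v"
  shows "poly_eval f v = tri t v v v"
proof -
  have "complex_of_real (poly_eval f v) = complex_of_real (tri t v v v)"
    using assms[of "cvec v"] by (simp add: poly_eval_complexify_cvec ctri_cvec)
  then show ?thesis by simp
qed

lemma partial_deriv_tri:
  fixes F :: "(3, complex) mpoly"
  assumes F: "\<And>v. poly_eval F v = tri t v v v" and "sym3 t"
  shows "poly_eval (partial_deriv l F) v = 3 * tri t v v (axis l 1)"
proof -
  let ?e = "axis l 1 :: complex ^ 3"
  have "((\<lambda>e. tri t v v v + 3 * e * tri t v v ?e + 3 * e\<^sup>2 * tri t v ?e ?e + e ^ 3 * tri t ?e ?e ?e)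
    has_field_derivative 3 * tri t v v ?e) (at 0)"
    by (auto intro!: derivative_eq_intros)
  moreover have "poly_eval F (v + e *s ?e) =
      tri t v v v + 3 * e * tri t v v ?e + 3 * e\<^sup>2 * tri t v ?e ?e + e ^ 3 * tri t ?e ?e ?e" for e
    by (simp add: F tri_add tri_scale tri_ac[OF \<open>sym3 t\<close>] power2_eq_square power3_eq_cube algebra_simps)
  ultimately show ?thesis
    using DERIV_unique[OF partial_deriv_has_derivative[of F v l]] by simp
qed


section \<open>Projective points\<close>

lemma abs_proj_eq_iff:
  assumes "v \<noteq> 0" "w \<noteq> 0"
  shows "abs_proj v = abs_proj w \<longleftrightarrow> (\<exists>c. w = c *s v)"
proof -
  have refl: "proportional u u" if "u \<noteq> 0" for u :: "'a ^ 'b"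
    unfolding proportional_def using that by (auto intro: exI[of _ 1])
  have "proportional v w \<longleftrightarrow> proportional v v \<and> proportional w w \<and> abs_proj v = abs_proj w"
    by (rule Quotient3_rel[OF Quotient3_proj, symmetric])
  with refl[OF assms(1)] refl[OF assms(2)] have "abs_proj v = abs_proj w \<longleftrightarrow> proportional v w"
    by blast
  with assms show ?thesis by (simp add: proportional_def)
qed

lemma abs_proj_scale:
  assumes "c \<noteq> 0" "v \<noteq> 0"
  shows "abs_proj (c *s v) = abs_proj v"
  using assms by (subst eq_commute) (auto simp: abs_proj_eq_iff)

lemma proj_cases:
  obtains v where "v \<noteq> 0" "p = abs_proj v"
proof -
  have "\<exists>v. v \<noteq> 0 \<and> p = abs_proj v"
    by (induction p rule: proj.abs_induct) (auto simp: proportional_def)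
  then show ?thesis using that by blast
qed

lemma complex_point_abs_proj:
  assumes "v \<noteq> 0"
  shows "complex_point (abs_proj v) = abs_proj (cvec v)"
proof -
  have "proportional v v" unfolding proportional_def using assms by (auto intro: exI[of _ 1])
  then show ?thesis by (simp add: complex_point.abs_eq cvec_def)
qed

lemma abs_proj_in_zeros_iff:
  assumes "v \<noteq> 0" "\<forall>p\<in>S. \<exists>d. homogeneous d p"
  shows "abs_proj v \<in> proj_zeros S \<longleftrightarrow> (\<forall>p\<in>S. poly_eval p v = 0)"
proof
  assume "abs_proj v \<in> proj_zeros S"
  then obtain w where w: "w \<noteq> 0" "abs_proj w = abs_proj v" "\<forall>p\<in>S. poly_eval p w = 0"
    by (auto simp: proj_zeros_def)
  then obtain c where "v = c *s w" using assms(1) abs_proj_eq_iff by blast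
  with w(3) assms(2) show "\<forall>p\<in>S. poly_eval p v = 0"
    by (metis mult_zero_right poly_eval_homogeneous)
qed (use assms in \<open>auto simp: proj_zeros_def\<close>)


section \<open>A singular irreducible cubic has no second singular point\<close>

text \<open>A common real zero is a common linear factor.  A common zero that is not real comes with its
  conjugate, so that the real quadratic with these two zeros divides the cubic part and is
  proportional to the quadratic part; the cofactor is linear.\<close>

lemma common_zero_factor:
  fixes A B C D E F G :: real and s z :: complex
  assumes nz: "s \<noteq> 0 \<or> z \<noteq> 0"
    and q: "A * s\<^sup>2 + B * s * z + C * z\<^sup>2 = 0"
    and k: "D * s ^ 3 + E * s\<^sup>2 * z + F * s * z\<^sup>2 + G * z ^ 3 = 0"
  obtains l1 l2 l3 m1 m2 m3 m4 m5 where
    "\<And>y s z :: real. y * (A * s\<^sup>2 + B * s * z + C * z\<^sup>2)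
       + (D * s ^ 3 + E * s\<^sup>2 * z + F * s * z\<^sup>2 + G * z ^ 3)
     = (l1 * y + l2 * s + l3 * z) * (m1 * y * s + m2 * y * z + m3 * s\<^sup>2 + m4 * s * z + m5 * z\<^sup>2)"
proof (cases "z = 0")
  case True
  with nz q k have AD: "A = 0" "D = 0" by auto
  show ?thesis
    by (rule that[of 0 0 1 B C E F G]) (simp add: AD algebra_simps power2_eq_square power3_eq_cube)
next
  case False
  define a b where "a = Re (s / z)" and "b = Im (s / z)"
  have ab: "s / z = Complex a b" by (simp add: a_def b_def)
  have "A * (s / z)\<^sup>2 + B * (s / z) + C = (A * s\<^sup>2 + B * s * z + C * z\<^sup>2) / z\<^sup>2"
    using False by (simp add: field_simps power2_eq_square)
  then have q': "A * (Complex a b)\<^sup>2 + B * Complex a b + C = 0" using q ab by simp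
  have "D * (s / z) ^ 3 + E * (s / z)\<^sup>2 + F * (s / z) + G
      = (D * s ^ 3 + E * s\<^sup>2 * z + F * s * z\<^sup>2 + G * z ^ 3) / z ^ 3"
    using False by (simp add: field_simps power2_eq_square power3_eq_cube)
  then have k': "D * (Complex a b) ^ 3 + E * (Complex a b)\<^sup>2 + F * Complex a b + G = 0"
    using k ab by simp
  from q' have "Re (A * (Complex a b)\<^sup>2 + B * Complex a b + C) = 0"
    "Im (A * (Complex a b)\<^sup>2 + B * Complex a b + C) = 0" by simp_all
  then have q1: "A * (a * a - b * b) + B * a + C = 0" and q2: "b * (2 * a * A + B) = 0"
    by (simp_all add: power2_eq_square algebra_simps)
  from k' have "Re (D * (Complex a b) ^ 3 + E * (Complex a b)\<^sup>2 + F * Complex a b + G) = 0"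
    "Im (D * (Complex a b) ^ 3 + E * (Complex a b)\<^sup>2 + F * Complex a b + G) = 0" by simp_all
  then have k1: "D * (a * a * a - 3 * a * b * b) + E * (a * a - b * b) + F * a + G = 0"
    and k2: "b * (D * (3 * a * a - b * b) + 2 * a * E + F) = 0"
    by (simp_all add: power2_eq_square power3_eq_cube algebra_simps)
  show ?thesis
  proof (cases "b = 0")
    case True
    have C: "C = - (A * (a * a) + B * a)" and G: "G = - (D * (a * a * a) + E * (a * a) + F * a)"
      using q1 k1 True by (simp_all add: algebra_simps)
    show ?thesis
      by (rule that[of 0 1 "- a" A "B + A * a" D "E + D * a" "F + E * a + D * a * a"])
        (simp add: C G algebra_simps power2_eq_square power3_eq_cube)
  next
    case False
    have B: "B = - (2 * a * A)" using q2 False by simp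
    have F: "F = - (D * (3 * a * a - b * b) + 2 * a * E)" using k2 False by simp
    have C: "C = - (A * (a * a - b * b) + B * a)" using q1 by simp
    have G: "G = - (D * (a * a * a - 3 * a * b * b) + E * (a * a - b * b) + F * a)"
      using k1 by simp
    show ?thesis
      by (rule that[of A D "E + 2 * a * D" 0 0 1 "- 2 * a" "a * a + b * b"])
        (simp add: G F C B algebra_simps power2_eq_square power3_eq_cube)
  qed
qed

lemma three_indices:
  fixes i j k x :: 3
  assumes "i \<noteq> j" "j \<noteq> k" "i \<noteq> k"
  shows "x = i \<or> x = j \<or> x = k"
  using assms exhaust_3[of i] exhaust_3[of j] exhaust_3[of k] exhaust_3[of x] by auto

text \<open>Around its singular point \<open>P\<close> the cubic is \<open>y q(s, z) + k(s, z)\<close> with respect to the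
  basis \<open>P, e\<^sub>k, e\<^sub>i\<close>.\<close>

locale singular_cubic =
  fixes f :: "(3, real) mpoly" and t :: "3 \<Rightarrow> 3 \<Rightarrow> 3 \<Rightarrow> real" and P :: "real ^ 3" and i j k :: 3
  assumes hom: "homogeneous 3 f"
    and irr: "irreducible f"
    and sym: "sym3 t"
    and eval: "\<And>v. poly_eval (complexify f) v = ctri t v v v"
    and ijk: "i \<noteq> j" "j \<noteq> k" "i \<noteq> k"
    and Pj: "P $ j = 1"
    and sing: "\<And>w. tri t P P w = 0"
begin

definition qf :: "'a::real_field \<Rightarrow> 'a \<Rightarrow> 'a" where
  "qf s z = of_real (3 * tri t P (axis k 1) (axis k 1)) * s\<^sup>2
    + of_real (6 * tri t P (axis k 1) (axis i 1)) * s * z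
    + of_real (3 * tri t P (axis i 1) (axis i 1)) * z\<^sup>2"

definition kf :: "'a::real_field \<Rightarrow> 'a \<Rightarrow> 'a" where
  "kf s z = of_real (tri t (axis k 1) (axis k 1) (axis k 1)) * s ^ 3
    + of_real (3 * tri t (axis k 1) (axis k 1) (axis i 1)) * s\<^sup>2 * z
    + of_real (3 * tri t (axis k 1) (axis i 1) (axis i 1)) * s * z\<^sup>2
    + of_real (tri t (axis i 1) (axis i 1) (axis i 1)) * z ^ 3"

lemma qf_scale: "qf (c * s) (c * z) = c\<^sup>2 * qf s z"
  and kf_scale: "kf (c * s) (c * z) = c ^ 3 * kf s z"
  by (simp_all add: qf_def kf_def power_mult_distrib algebra_simps power2_eq_square power3_eq_cube)

lemmas three = three_indices[OF ijk]

lemma real_eval: "poly_eval f v = tri t v v v"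
  by (rule poly_eval_tri[OF eval])

lemma P_nonzero: "P \<noteq> 0"
  using Pj by auto

lemma csing: "ctri t (cvec P) (cvec P) w = 0"
proof -
  have w: "w = cvec (\<chi> l. Re (w $ l)) + \<i> *s cvec (\<chi> l. Im (w $ l))"
    by (simp add: vec_eq_iff complex_eq_iff)
  show ?thesis by (subst w) (simp add: tri_add tri_scale ctri_cvec sing)
qed

lemma coordinates:
  fixes v :: "'a::comm_ring_1 ^ 3"
  assumes "p $ j = 1"
  shows "v = v $ j *s p + (v $ k - p $ k * v $ j) *s axis k 1 + (v $ i - p $ i * v $ j) *s axis i 1"
proof -
  have "v $ x = (v $ j *s p + (v $ k - p $ k * v $ j) *s axis k 1 + (v $ i - p $ i * v $ j) *s axis i 1) $ x"
    for x using three[of x] ijk assms by (auto simp: axis_def)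
  then show ?thesis unfolding vec_eq_iff by blast
qed

lemma real_eval_coordinates:
  "poly_eval f (y *s P + s *s a + z *s b) =
    y * (3 * tri t P a a * s\<^sup>2 + 6 * tri t P a b * s * z + 3 * tri t P b b * z\<^sup>2) +
    (tri t a a a * s ^ 3 + 3 * tri t a a b * s\<^sup>2 * z + 3 * tri t a b b * s * z\<^sup>2 + tri t b b b * z ^ 3)"
  unfolding real_eval tri_expand[OF sym] by (simp add: sing)

lemma eval_coordinates:
  "poly_eval (complexify f) (y *s cvec P + s *s cvec a + z *s cvec b) =
    y * (of_real (3 * tri t P a a) * s\<^sup>2 + of_real (6 * tri t P a b) * s * z + of_real (3 * tri t P b b) * z\<^sup>2) +
    (of_real (tri t a a a) * s ^ 3 + of_real (3 * tri t a a b) * s\<^sup>2 * z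
      + of_real (3 * tri t a b b) * s * z\<^sup>2 + of_real (tri t b b b) * z ^ 3)"
  unfolding eval tri_expand[OF sym3_of_real[OF sym]] by (simp add: ctri_cvec sing csing)

lemma eval_qf_kf:
  "poly_eval (complexify f) (y *s cvec P + s *s axis k 1 + z *s axis i 1) = y * qf s z + kf s z"
  using eval_coordinates[of y s "axis k 1" z "axis i 1"] by (simp add: qf_def kf_def cvec_axis)

lemma real_eval_qf_kf:
  "poly_eval f (y *s P + s *s axis k 1 + z *s axis i 1) = y * qf s z + kf s z"
  using real_eval_coordinates[of y s "axis k 1" z "axis i 1"] by (simp add: qf_def kf_def)

lemma of_real_qf: "qf (complex_of_real s) (of_real z) = of_real (qf s z)"
  and of_real_kf: "kf (complex_of_real s) (of_real z) = of_real (kf s z)"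
  by (simp_all add: qf_def kf_def)

text \<open>Irreducibility enters the study of the singular point only through this fact.\<close>

lemma no_common_zero:
  fixes s z :: complex
  assumes "qf s z = 0" "kf s z = 0"
  shows "s = 0 \<and> z = 0"
proof (rule ccontr)
  assume "\<not> (s = 0 \<and> z = 0)"
  then have nz: "s \<noteq> 0 \<or> z \<noteq> 0" by blast
  from common_zero_factor[OF nz assms[unfolded qf_def kf_def]]
  obtain l1 l2 l3 m1 m2 m3 m4 m5 where lm:
    "\<And>y s z :: real. y * qf s z + kf s z
     = (l1 * y + l2 * s + l3 * z) * (m1 * y * s + m2 * y * z + m3 * s\<^sup>2 + m4 * s * z + m5 * z\<^sup>2)"
    unfolding qf_def kf_def of_real_eq_id id_apply by blast
  define Y S Z :: "(3, real) mpoly" where "Y = poly_var j"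
    and "S = poly_var k - poly_const (P $ k) * poly_var j"
    and "Z = poly_var i - poly_const (P $ i) * poly_var j"
  define L where "L = poly_const l1 * Y + poly_const l2 * S + poly_const l3 * Z"
  define M where "M = poly_const m1 * (Y * S) + poly_const m2 * (Y * Z) + poly_const m3 * (S * S)
    + poly_const m4 * (S * Z) + poly_const m5 * (Z * Z)"
  have lin: "homogeneous 1 Y" "homogeneous 1 S" "homogeneous 1 Z"
    unfolding Y_def S_def Z_def by (auto intro!: homogeneous_diff)
  have "homogeneous 1 L" unfolding L_def using lin by (intro homogeneous_add homogeneous_const_mult)
  moreover have "homogeneous 2 M" unfolding M_def
    using lin by (intro homogeneous_add homogeneous_const_mult homogeneous_mult[of 1 _ 1]) auto
  ultimately have "homogeneous 3 (L * M)" by (rule homogeneous_mult) simp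
  moreover have "poly_eval f v = poly_eval (L * M) v" for v
  proof -
    have "poly_eval f v = v $ j * qf (v $ k - P $ k * v $ j) (v $ i - P $ i * v $ j)
        + kf (v $ k - P $ k * v $ j) (v $ i - P $ i * v $ j)"
      by (rule trans[OF arg_cong[OF coordinates[OF Pj], of "poly_eval f"] real_eval_qf_kf])
    also have "\<dots> = poly_eval (L * M) v"
      unfolding lm by (simp add: L_def M_def Y_def S_def Z_def power2_eq_square mult.assoc)
    finally show ?thesis .
  qed
  ultimately have "f = L * M" using hom by (intro ternary_cubic_eqI) auto
  then show False
    by (rule not_irreducible_product[OF irr]) (simp_all add: L_def M_def Y_def S_def Z_def)
qed

lemma no_real_common_zero:
  fixes s z :: real
  assumes "qf s z = 0" "kf s z = 0"
  shows "s = 0 \<and> z = 0"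
  using no_common_zero[of "of_real s" "of_real z"] assms by (simp add: of_real_qf of_real_kf)

lemma coordinates_exist:
  fixes v :: "complex ^ 3"
  shows "\<exists>y s z. v = y *s cvec P + s *s axis k 1 + z *s axis i 1"
  by (intro exI) (rule coordinates, simp add: Pj)

lemma coordinates_zero_iff:
  fixes y s z :: complex
  shows "y *s cvec P + s *s axis k 1 + z *s axis i 1 = 0 \<longleftrightarrow> y = 0 \<and> s = 0 \<and> z = 0"
proof
  assume *: "y *s cvec P + s *s axis k 1 + z *s axis i 1 = 0"
  have "(y *s cvec P + s *s axis k 1 + z *s axis i 1) $ x = 0" for x using * by simp
  from this[of j] this[of k] this[of i] show "y = 0 \<and> s = 0 \<and> z = 0"
    using ijk Pj by (auto simp: axis_def)
qed simp

text \<open>At a singular point \<open>y P + s e\<^sub>k + z e\<^sub>i\<close> the derivative in the direction \<open>P\<close> is \<open>q(s, z)\<close>; if it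
  vanishes, the equation reduces to \<open>k(s, z) = 0\<close>.\<close>

lemma singular_point_unique:
  "singular_points (complexify f) = {complex_point (abs_proj P)}"
proof -
  have grad: "(\<forall>l. poly_eval (partial_deriv l (complexify f)) v = 0) \<longleftrightarrow> (\<forall>w. ctri t v v w = 0)" for v
  proof
    assume *: "\<forall>l. poly_eval (partial_deriv l (complexify f)) v = 0"
    have ax: "ctri t v v (axis l 1) = 0" for l
      using * partial_deriv_tri[OF eval sym3_of_real[OF sym], of l v] by simp
    show "\<forall>w. ctri t v v w = 0" using tri_eq_0_if_axis[OF ax] by blast
  next
    assume "\<forall>w. ctri t v v w = 0"
    then show "\<forall>l. poly_eval (partial_deriv l (complexify f)) v = 0"
      using partial_deriv_tri[OF eval sym3_of_real[OF sym]] by simp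
  qed
  have P0: "cvec P \<noteq> 0" using P_nonzero by simp
  have "v \<noteq> 0 \<and> poly_eval (complexify f) v = 0 \<and> (\<forall>w. ctri t v v w = 0)
      \<longleftrightarrow> v \<noteq> 0 \<and> abs_proj v = abs_proj (cvec P)" for v
  proof
    assume v: "v \<noteq> 0 \<and> poly_eval (complexify f) v = 0 \<and> (\<forall>w. ctri t v v w = 0)"
    obtain y s z where ysz: "v = y *s cvec P + s *s axis k 1 + z *s axis i 1"
      using coordinates_exist by blast
    have "3 * ctri t v v (cvec P) = 3 * ctri t (cvec P) v v"
      by (simp add: tri_ac[OF sym3_of_real[OF sym]])
    also have "\<dots> = qf s z"
      unfolding ysz qf_def tri_polar[OF sym3_of_real[OF sym]]
      by (simp add: csing distrib_left mult_ac flip: ctri_cvec cvec_axis)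
    finally have q0: "qf s z = 0" using v by simp
    have "y * qf s z + kf s z = 0" using v unfolding ysz eval_qf_kf by blast
    with q0 have "s = 0 \<and> z = 0" by (intro no_common_zero) simp_all
    with ysz v have "v = y *s cvec P" "y \<noteq> 0" by auto
    with P0 v show "v \<noteq> 0 \<and> abs_proj v = abs_proj (cvec P)" by (simp add: abs_proj_scale)
  next
    assume v: "v \<noteq> 0 \<and> abs_proj v = abs_proj (cvec P)"
    then obtain c where c: "v = c *s cvec P" using P0 abs_proj_eq_iff by metis
    then show "v \<noteq> 0 \<and> poly_eval (complexify f) v = 0 \<and> (\<forall>w. ctri t v v w = 0)"
      using v by (simp add: eval tri_scale csing)
  qed
  then have "singular_points (complexify f) = {abs_proj v | v. v \<noteq> 0 \<and> abs_proj v = abs_proj (cvec P)}"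
    unfolding singular_points_def grad by auto
  also have "\<dots> = {abs_proj (cvec P)}" using P0 by auto
  finally show ?thesis by (simp add: complex_point_abs_proj P_nonzero)
qed


lemma V_complex_iff: "v \<noteq> 0 \<Longrightarrow> abs_proj v \<in> V_complex f \<longleftrightarrow> poly_eval (complexify f) v = 0"
  unfolding V_complex_def using homogeneous_complexify[OF hom]
  by (subst abs_proj_in_zeros_iff) auto


section \<open>Rational parametrization\<close>

text \<open>The line through \<open>P\<close> in direction \<open>(s, z)\<close> meets the cubic in one further point, which
  depends polynomially on \<open>(s, z)\<close>.\<close>

definition qpoly :: "(2, complex) mpoly" where
  "qpoly = poly_const (of_real (3 * tri t P (axis k 1) (axis k 1))) * (poly_var 1 * poly_var 1)
    + poly_const (of_real (6 * tri t P (axis k 1) (axis i 1))) * (poly_var 1 * poly_var 2)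
    + poly_const (of_real (3 * tri t P (axis i 1) (axis i 1))) * (poly_var 2 * poly_var 2)"

definition kpoly :: "(2, complex) mpoly" where
  "kpoly = poly_const (of_real (tri t (axis k 1) (axis k 1) (axis k 1))) * (poly_var 1 * (poly_var 1 * poly_var 1))
    + poly_const (of_real (3 * tri t (axis k 1) (axis k 1) (axis i 1))) * (poly_var 1 * (poly_var 1 * poly_var 2))
    + poly_const (of_real (3 * tri t (axis k 1) (axis i 1) (axis i 1))) * (poly_var 1 * (poly_var 2 * poly_var 2))
    + poly_const (of_real (tri t (axis i 1) (axis i 1) (axis i 1))) * (poly_var 2 * (poly_var 2 * poly_var 2))"

definition param :: "3 \<Rightarrow> (2, complex) mpoly" where
  "param l = poly_const (- of_real (P $ l)) * kpoly
    + poly_const (if l = k then 1 else 0) * (qpoly * poly_var 1)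
    + poly_const (if l = i then 1 else 0) * (qpoly * poly_var 2)"

definition project :: "2 \<Rightarrow> (3, complex) mpoly" where
  "project x = (if x = 1 then poly_var k - poly_const (of_real (P $ k)) * poly_var j
    else poly_var i - poly_const (of_real (P $ i)) * poly_var j)"

lemma homogeneous_qpoly: "homogeneous 2 qpoly"
  unfolding qpoly_def
  by (intro homogeneous_add homogeneous_const_mult homogeneous_mult[OF homogeneous_var homogeneous_var]) simp_all

lemma homogeneous_kpoly: "homogeneous 3 kpoly"
  unfolding kpoly_def
  by (intro homogeneous_add homogeneous_const_mult
      homogeneous_mult[OF homogeneous_var homogeneous_mult[OF homogeneous_var homogeneous_var refl]]) simp_all

lemma homogeneous_param: "homogeneous 3 (param l)"
  unfolding param_def
  by (intro homogeneous_add homogeneous_const_mult homogeneous_kpoly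
      homogeneous_mult[OF homogeneous_qpoly homogeneous_var]) simp_all

lemma homogeneous_project: "homogeneous 1 (project x)"
  unfolding project_def by (auto intro!: homogeneous_diff)

lemma eval_qpoly: "poly_eval qpoly w = qf (w $ 1) (w $ 2)"
  and eval_kpoly: "poly_eval kpoly w = kf (w $ 1) (w $ 2)"
  by (simp_all add: qpoly_def kpoly_def qf_def kf_def power2_eq_square power3_eq_cube mult.assoc)

lemma eval_param:
  "eval_tuple param w = (- kf (w $ 1) (w $ 2)) *s cvec P
    + (qf (w $ 1) (w $ 2) * w $ 1) *s axis k 1 + (qf (w $ 1) (w $ 2) * w $ 2) *s axis i 1"
  by (simp add: vec_eq_iff eval_tuple_def param_def eval_qpoly eval_kpoly axis_def)

lemma eval_project:
  "eval_tuple project (y *s cvec P + s *s axis k 1 + z *s axis i 1) = vector [s, z]"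
  using ijk Pj by (simp add: vec_eq_iff forall_2 eval_tuple_def project_def axis_def)

lemma param_nonzero:
  assumes "w \<noteq> 0"
  shows "eval_tuple param w \<noteq> 0"
proof
  assume "eval_tuple param w = 0"
  then have "kf (w $ 1) (w $ 2) = 0" "qf (w $ 1) (w $ 2) * w $ 1 = 0" "qf (w $ 1) (w $ 2) * w $ 2 = 0"
    unfolding eval_param coordinates_zero_iff by auto
  then have "w $ 1 = 0 \<and> w $ 2 = 0" using no_common_zero[of "w $ 1" "w $ 2"] by auto
  with assms show False by (simp add: vec_eq_iff forall_2)
qed

lemma param_on_curve: "poly_eval (complexify f) (eval_tuple param w) = 0"
  unfolding eval_param eval_qf_kf qf_scale kf_scale
  by (simp add: power2_eq_square power3_eq_cube)

text \<open>Projection from \<open>P\<close> undoes the parametrization.\<close>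

lemma param_project:
  assumes "poly_eval (complexify f) (y *s cvec P + s *s axis k 1 + z *s axis i 1) = 0"
  shows "eval_tuple param (vector [s, z]) = qf s z *s (y *s cvec P + s *s axis k 1 + z *s axis i 1)"
proof -
  have "- kf s z = y * qf s z" using assms unfolding eval_qf_kf by (simp add: neg_eq_iff_add_eq_0 add.commute)
  then show ?thesis unfolding eval_param by (simp add: vec_eq_iff algebra_simps)
qed

lemma project_param:
  "eval_tuple project (eval_tuple param w) = qf (w $ 1) (w $ 2) *s w"
  unfolding eval_param eval_project by (simp add: vec_eq_iff forall_2)

lemma qf_nonzero:
  assumes "poly_eval (complexify f) (y *s cvec P + s *s axis k 1 + z *s axis i 1) = 0"
    and "s \<noteq> 0 \<or> z \<noteq> 0"
  shows "qf s z \<noteq> 0"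
  using no_common_zero[of s z] assms unfolding eval_qf_kf by auto

lemma complex_quadratic_root:
  fixes a b c :: complex
  assumes "a \<noteq> 0"
  shows "\<exists>r. a * r\<^sup>2 + b * r + c = 0"
proof
  let ?d = "csqrt (b\<^sup>2 - 4 * a * c)"
  let ?r = "(?d - b) / (2 * a)"
  have "4 * a * (a * r\<^sup>2 + b * r + c) = (2 * a * r + b)\<^sup>2 - (b\<^sup>2 - 4 * a * c)" for r
    by (simp add: power2_eq_square algebra_simps)
  from this[of ?r] have "4 * a * (a * ?r\<^sup>2 + b * ?r + c) = (2 * a * ?r + b)\<^sup>2 - (b\<^sup>2 - 4 * a * c)" .
  also have "2 * a * ?r + b = ?d" using assms by simp
  finally show "a * ?r\<^sup>2 + b * ?r + c = 0" using assms by simp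
qed

lemma param_surjective:
  assumes A: "tri t P (axis k 1) (axis k 1) \<noteq> 0"
    and v: "v \<noteq> 0" "poly_eval (complexify f) v = 0"
  shows "\<exists>w. w \<noteq> 0 \<and> abs_proj (eval_tuple param w) = abs_proj v"
proof -
  obtain y s z where ysz: "v = y *s cvec P + s *s axis k 1 + z *s axis i 1"
    using coordinates_exist by blast
  show ?thesis
  proof (cases "s = 0 \<and> z = 0")
    case False
    then have "qf s z \<noteq> 0" using qf_nonzero[of y s z] v(2) unfolding ysz by blast
    moreover have "eval_tuple param (vector [s, z]) = qf s z *s v"
      using param_project[of y s z] v(2) unfolding ysz by blast
    moreover have "vector [s, z] \<noteq> (0 :: complex ^ 2)"
      using False by (simp add: vec_eq_iff forall_2)
    ultimately show ?thesis using v by (intro exI[of _ "vector [s, z]"]) (simp add: abs_proj_scale)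
  next
    case True
    let ?a = "complex_of_real (3 * tri t P (axis k 1) (axis k 1))"
    let ?b = "complex_of_real (6 * tri t P (axis k 1) (axis i 1))"
    let ?c = "complex_of_real (3 * tri t P (axis i 1) (axis i 1))"
    have "?a \<noteq> 0" using A by simp
    then obtain r where r: "?a * r\<^sup>2 + ?b * r + ?c = 0"
      using complex_quadratic_root by blast
    then have q0: "qf r 1 = 0" unfolding qf_def by simp
    then have k0: "kf r 1 \<noteq> 0" using no_common_zero[of r 1] by auto
    from True v ysz have y: "v = y *s cvec P" "y \<noteq> 0" by auto
    have "eval_tuple param (vector [r, 1]) = (- kf r 1) *s cvec P"
      unfolding eval_param using q0 by simp
    then have "abs_proj (eval_tuple param (vector [r, 1])) = abs_proj v"
      using k0 P_nonzero unfolding y(1)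
      by (simp only: abs_proj_scale neg_equal_0_iff_equal cvec_eq_0_iff y(2) not_False_eq_True)
    moreover have "vector [r, 1] \<noteq> (0 :: complex ^ 2)" by (simp add: vec_eq_iff forall_2)
    ultimately show ?thesis by blast
  qed
qed

end

definition polyfun :: "(complex \<Rightarrow> complex) \<Rightarrow> bool" where
  "polyfun h \<longleftrightarrow> (\<exists>p. h = poly p)"

lemma polyfun_const: "polyfun (\<lambda>x. c)"
  unfolding polyfun_def by (intro exI[of _ "[:c:]"]) auto

lemma polyfun_id: "polyfun (\<lambda>x. x)"
  unfolding polyfun_def by (intro exI[of _ "[:0, 1:]"]) auto

lemma polyfun_add:
  assumes "polyfun g" "polyfun h"
  shows "polyfun (\<lambda>x. g x + h x)"
proof -
  obtain p q where "g = poly p" "h = poly q" using assms by (auto simp: polyfun_def)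
  then have "(\<lambda>x. g x + h x) = poly (p + q)" by (simp add: fun_eq_iff)
  then show ?thesis unfolding polyfun_def by blast
qed

lemma polyfun_mult:
  assumes "polyfun g" "polyfun h"
  shows "polyfun (\<lambda>x. g x * h x)"
proof -
  obtain p q where "g = poly p" "h = poly q" using assms by (auto simp: polyfun_def)
  then have "(\<lambda>x. g x * h x) = poly (p * q)" by (simp add: fun_eq_iff)
  then show ?thesis unfolding polyfun_def by blast
qed

lemma polyfun_sum: "(\<And>a. a \<in> A \<Longrightarrow> polyfun (g a)) \<Longrightarrow> polyfun (\<lambda>x. \<Sum>a\<in>A. g a x)"
  by (induction A rule: infinite_finite_induct) (simp_all add: polyfun_const polyfun_add)

lemma polyfun_prod: "(\<And>a. a \<in> A \<Longrightarrow> polyfun (g a)) \<Longrightarrow> polyfun (\<lambda>x. \<Prod>a\<in>A. g a x)"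
  by (induction A rule: infinite_finite_induct) (simp_all add: polyfun_const polyfun_mult)

lemma polyfun_power: "polyfun g \<Longrightarrow> polyfun (\<lambda>x. g x ^ n)"
  by (induction n) (simp_all add: polyfun_const polyfun_mult)

lemma polyfun_poly_eval:
  assumes "\<And>l. polyfun (\<lambda>x. u x $ l)"
  shows "polyfun (\<lambda>x. poly_eval p (u x))"
  unfolding poly_eval_def
  by (intro polyfun_sum polyfun_mult polyfun_const polyfun_prod polyfun_power assms)

lemma polyfun_mult_eq_0:
  assumes "polyfun g" "polyfun h" "\<And>x. g x * h x = 0" "g a \<noteq> 0"
  shows "h x = 0"
proof -
  obtain p q where pq: "g = poly p" "h = poly q" using assms by (auto simp: polyfun_def)
  have "poly (p * q) y = 0" for y using assms(3)[of y] by (simp add: pq)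
  then have "p * q = 0" using poly_all_0_iff_0 by blast
  moreover have "p \<noteq> 0" using assms(4) pq by auto
  ultimately show ?thesis by (simp add: pq)
qed

context singular_cubic
begin

text \<open>The curve is the image of the projective line.  If two closed sets properly contained in it
  covered it, each would come with a form that vanishes on it but not on the whole curve; the product
  of the two forms would vanish on the curve.  Pulling back to the line through two parameters at which
  the factors do not vanish contradicts that univariate polynomials have no zero divisors.\<close>

lemma irreducible_variety_V:
  assumes A: "tri t P (axis k 1) (axis k 1) \<noteq> 0"
  shows "irreducible_variety (V_complex f)"
  unfolding irreducible_variety_def
proof (intro conjI allI impI)
  show "zariski_closed (V_complex f)"
    unfolding zariski_closed_def V_complex_def
    using homogeneous_complexify[OF hom] by (intro exI[of _ "{complexify f}"]) auto
  have "abs_proj (cvec P) \<in> V_complex f"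
    using P_nonzero by (simp add: V_complex_iff eval csing)
  then show "V_complex f \<noteq> {}" by blast
  fix X Y :: "(complex, 3) proj set"
  assume X: "zariski_closed X" and Y: "zariski_closed Y" and XY: "V_complex f = X \<union> Y"
  have witness: "\<exists>p w. w \<noteq> 0 \<and> poly_eval p (eval_tuple param w) \<noteq> 0 \<and>
      (\<forall>w. w \<noteq> 0 \<longrightarrow> abs_proj (eval_tuple param w) \<in> X \<longrightarrow> poly_eval p (eval_tuple param w) = 0)"
    if "zariski_closed X" "X \<subseteq> V_complex f" "X \<noteq> V_complex f" for X :: "(complex, 3) proj set"
  proof -
    obtain S where S: "\<forall>p\<in>S. \<exists>d. homogeneous d p" "X = proj_zeros S"
      using \<open>zariski_closed X\<close> by (auto simp: zariski_closed_def)
    from that obtain x where x: "x \<in> V_complex f" "x \<notin> X" by blast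
    obtain v where v: "v \<noteq> 0" "x = abs_proj v" by (rule proj_cases)
    with x V_complex_iff have "poly_eval (complexify f) v = 0" by simp
    with param_surjective[OF A v(1)] obtain w where
      w: "w \<noteq> 0" "abs_proj (eval_tuple param w) = x" using v by blast
    have iff: "abs_proj (eval_tuple param w) \<in> X \<longleftrightarrow> (\<forall>p\<in>S. poly_eval p (eval_tuple param w) = 0)"
      if "w \<noteq> 0" for w
      unfolding S(2) by (rule abs_proj_in_zeros_iff) (use param_nonzero that S in auto)
    show ?thesis using iff w x by metis
  qed
  show "V_complex f = X \<or> V_complex f = Y"
  proof (rule ccontr)
    assume *: "\<not> (V_complex f = X \<or> V_complex f = Y)"
    obtain p a where p: "a \<noteq> 0" "poly_eval p (eval_tuple param a) \<noteq> 0"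
      "\<And>w. w \<noteq> 0 \<Longrightarrow> abs_proj (eval_tuple param w) \<in> X \<Longrightarrow> poly_eval p (eval_tuple param w) = 0"
      using witness[OF X] XY * by blast
    obtain q b where q: "b \<noteq> 0" "poly_eval q (eval_tuple param b) \<noteq> 0"
      "\<And>w. w \<noteq> 0 \<Longrightarrow> abs_proj (eval_tuple param w) \<in> Y \<Longrightarrow> poly_eval q (eval_tuple param w) = 0"
      using witness[OF Y] XY * by blast
    define u where "u x = a + x *s (b - a)" for x
    have u: "polyfun (\<lambda>x. u x $ l)" for l
      unfolding u_def vector_add_component vector_smult_component
      by (intro polyfun_add polyfun_mult polyfun_const polyfun_id)
    have pu: "polyfun (\<lambda>x. poly_eval p (eval_tuple param (u x)))" for p
      by (rule polyfun_poly_eval) (simp add: eval_tuple_def polyfun_poly_eval u)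
    obtain l where l: "a $ l \<noteq> 0" using p(1) by (auto simp: vec_eq_iff)
    have u01: "u 0 = a" "u 1 = b" by (simp_all add: u_def)
    have zero: "u x $ l * (poly_eval p (eval_tuple param (u x)) * poly_eval q (eval_tuple param (u x))) = 0" for x
    proof (cases "u x = 0")
      case False
      then have "abs_proj (eval_tuple param (u x)) \<in> V_complex f"
        by (simp add: V_complex_iff param_nonzero param_on_curve)
      then show ?thesis using XY p(3) q(3) False by auto
    qed simp
    have "poly_eval p (eval_tuple param (u x)) * poly_eval q (eval_tuple param (u x)) = 0" for x
      by (rule polyfun_mult_eq_0[OF u polyfun_mult[OF pu pu] zero, where a = 0])
        (simp add: u01 l)
    then have "poly_eval q (eval_tuple param (u 1)) = 0"
      by (rule polyfun_mult_eq_0[OF pu pu, where a = 0]) (simp add: u01 p(2))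
    then show False using q(2) by (simp add: u01)
  qed
qed

lemma rational_curve_V:
  assumes A: "tri t P (axis k 1) (axis k 1) \<noteq> 0"
  shows "rational_curve (V_complex f)"
proof -
  let ?Z = "proj_zeros (range project)"
  let ?Q = "proj_zeros {qpoly}"
  define U where "U = V_complex f - ?Z"
  define W where "W = UNIV - ?Q"
  have Z: "abs_proj v \<in> ?Z \<longleftrightarrow> eval_tuple project v = 0" if "v \<noteq> 0" for v
    using that homogeneous_project
    by (subst abs_proj_in_zeros_iff) (auto simp: eval_tuple_def vec_eq_iff)
  have W: "abs_proj w \<in> W \<longleftrightarrow> qf (w $ 1) (w $ 2) \<noteq> 0" if "w \<noteq> 0" for w
    unfolding W_def using that homogeneous_qpoly
    by (subst Diff_iff, subst abs_proj_in_zeros_iff) (auto simp: eval_qpoly)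
  have U: "abs_proj v \<in> U \<longleftrightarrow> poly_eval (complexify f) v = 0 \<and> eval_tuple project v \<noteq> 0" if "v \<noteq> 0" for v
    unfolding U_def using that by (simp add: Z V_complex_iff)
  have GF: "eval_tuple project v \<noteq> 0 \<and> abs_proj (eval_tuple project v) \<in> W \<and>
      abs_proj (eval_tuple param (eval_tuple project v)) = abs_proj v"
    if v: "v \<noteq> 0" "abs_proj v \<in> U" for v
  proof -
    obtain y s z where ysz: "v = y *s cvec P + s *s axis k 1 + z *s axis i 1"
      using coordinates_exist by blast
    have v': "poly_eval (complexify f) v = 0" "eval_tuple project v \<noteq> 0" using U v by auto
    have pr: "eval_tuple project v = vector [s, z]" unfolding ysz by (rule eval_project)
    have "s \<noteq> 0 \<or> z \<noteq> 0" using v' pr by (auto simp: vec_eq_iff forall_2)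
    then have q0: "qf s z \<noteq> 0" using qf_nonzero[of y s z] v'(1) unfolding ysz by blast
    have "eval_tuple param (eval_tuple project v) = qf s z *s v"
      unfolding pr using param_project[of y s z] v'(1) unfolding ysz by blast
    then show ?thesis using q0 v v' W pr by (simp add: abs_proj_scale)
  qed
  have FG: "eval_tuple param w \<noteq> 0 \<and> abs_proj (eval_tuple param w) \<in> U \<and>
      abs_proj (eval_tuple project (eval_tuple param w)) = abs_proj w"
    if w: "w \<noteq> 0" "abs_proj w \<in> W" for w
    using w W U[OF param_nonzero[OF w(1)]]
    by (simp add: param_nonzero param_on_curve project_param abs_proj_scale)
  let ?w = "vector [1, 0] :: complex ^ 2"
  have w: "?w \<noteq> 0" by (simp add: vec_eq_iff forall_2)
  have wW: "abs_proj ?w \<in> W" using A by (simp add: W w qf_def)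
  have closed: "zariski_closed ?Q" "zariski_closed ?Z"
    unfolding zariski_closed_def using homogeneous_qpoly homogeneous_project by blast+
  have "nonempty_zariski_open_in UNIV W"
    unfolding nonempty_zariski_open_in_def using wW closed(1) unfolding W_def by blast
  moreover have "nonempty_zariski_open_in (V_complex f) U"
    unfolding nonempty_zariski_open_in_def using FG[OF w wW] closed(2) unfolding U_def by blast
  moreover have "forms_map project U W" "forms_map param W U"
    unfolding forms_map_def using GF FG homogeneous_project homogeneous_param by blast+
  ultimately have "birational (V_complex f) (UNIV :: (complex, 2) proj set)"
    unfolding birational_def using GF FG by (intro exI[of _ U] exI[of _ W] exI[of _ project] exI[of _ param]) auto
  then show ?thesis
    unfolding rational_curve_def using irreducible_variety_V[OF A] by blast
qed

end


section \<open>Local analytic equations of a node and of a cusp\<close>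

definition has_gradient2 :: "(complex \<times> complex \<Rightarrow> complex) \<Rightarrow> complex \<Rightarrow> complex \<Rightarrow> complex \<times> complex \<Rightarrow> bool" where
  "has_gradient2 g a b x \<longleftrightarrow> (g has_derivative (\<lambda>(s, t). a * s + b * t)) (at x)"

lemma has_gradient2_const: "has_gradient2 (\<lambda>x. c) 0 0 x"
  by (simp add: has_gradient2_def case_prod_unfold)

lemma has_gradient2_fst: "has_gradient2 fst 1 0 x"
  and has_gradient2_snd: "has_gradient2 snd 0 1 x"
  by (auto simp: has_gradient2_def case_prod_unfold intro!: derivative_eq_intros)

lemma has_gradient2_add: "has_gradient2 g a b x \<Longrightarrow> has_gradient2 h c d x \<Longrightarrow> has_gradient2 (\<lambda>x. g x + h x) (a + c) (b + d) x"
  unfolding has_gradient2_def case_prod_unfold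
  by (auto intro!: derivative_eq_intros simp: algebra_simps)

lemma has_gradient2_mult:
  "has_gradient2 g a b x \<Longrightarrow> has_gradient2 h c d x \<Longrightarrow>
    has_gradient2 (\<lambda>x. g x * h x) (g x * c + a * h x) (g x * d + b * h x) x"
  unfolding has_gradient2_def case_prod_unfold
  by (auto intro!: derivative_eq_intros simp: algebra_simps)

lemma has_gradient2_comp:
  assumes "has_gradient2 g a b x" "(h has_field_derivative h') (at (g x))"
  shows "has_gradient2 (\<lambda>x. h (g x)) (h' * a) (h' * b) x"
  using has_derivative_compose[OF assms(1)[unfolded has_gradient2_def] assms(2)[unfolded has_field_derivative_def]]
  by (simp add: has_gradient2_def case_prod_unfold algebra_simps)

lemmas has_gradient2_arith = has_gradient2_const has_gradient2_fst has_gradient2_snd has_gradient2_add has_gradient2_mult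

lemma has_gradient2_eqI: "has_gradient2 g a b x \<Longrightarrow> a = a' \<Longrightarrow> b = b' \<Longrightarrow> has_gradient2 g a' b' x"
  by simp

lemma local_coordinatesI:
  assumes "open U" "0 \<in> U" "X 0 = 0" "Y 0 = 0"
    and d: "\<And>x. x \<in> U \<Longrightarrow> \<exists>a b c d. has_gradient2 X a b x \<and> has_gradient2 Y c d x \<and> (x = 0 \<longrightarrow> a * d - b * c \<noteq> 0)"
  shows "local_coordinates X Y"
proof -
  have "holomorphic2_on X U" "holomorphic2_on Y U"
    unfolding holomorphic2_on_def using d unfolding has_gradient2_def by blast+
  moreover obtain a b c d where "has_gradient2 X a b 0" "has_gradient2 Y c d 0" "a * d - b * c \<noteq> 0"
    using d[OF \<open>0 \<in> U\<close>] by blast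
  ultimately show ?thesis
    unfolding local_coordinates_def using assms(1-4) unfolding has_gradient2_def by blast
qed

lemma csqrt_derivative:
  assumes "Re z > 0"
  shows "(csqrt has_field_derivative inverse (2 * csqrt z)) (at z)"
  using assms by (intro has_field_derivative_csqrt) (auto simp: complex_nonpos_Reals_iff)

text \<open>Because the direction \<open>s = 0\<close> points to a further point of the curve, the equation has degree 2
  in \<open>t\<close>, and its two roots are the branches.  The discriminant is \<open>-s\<^sup>2 w(s)\<close> with \<open>Re (w(0)) > 0\<close>, where
  the principal square root is holomorphic.\<close>

lemma node_coordinates:
  fixes A B C D E F :: complex
  assumes C: "C \<noteq> 0" and disc: "Re (4 * A * C - B\<^sup>2) > 0"
  obtains X Y where "local_coordinates X Y"
    "\<forall>\<^sub>F x :: complex \<times> complex in nhds 0. (case x of (s, t) \<Rightarrow> A * s\<^sup>2 + B * s * t + C * t\<^sup>2 + D * s ^ 3 + E * s\<^sup>2 * t + F * s * t\<^sup>2)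
      = X x * Y x"
proof -
  define u :: "complex \<times> complex \<Rightarrow> complex" where "u x = C + F * fst x" for x
  define w :: "complex \<times> complex \<Rightarrow> complex" where
    "w x = 4 * (u x * (A + D * fst x)) + (- 1) * ((B + E * fst x) * (B + E * fst x))" for x
  define L :: "complex \<times> complex \<Rightarrow> complex" where
    "L x = u x * snd x + (1 / 2) * (fst x * (B + E * fst x))" for x
  define N :: "complex \<times> complex \<Rightarrow> complex" where "N x = (\<i> / 2) * (fst x * csqrt (w x))" for x
  define X where "X x = L x + N x" for x
  define Y where "Y x = (L x + (- 1) * N x) * inverse (u x)" for x
  define U where "U = {x. Re (w x) > 0 \<and> u x \<noteq> 0}"
  have u: "has_gradient2 u F 0 x" for x
    unfolding u_def by (rule has_gradient2_eqI, (rule has_gradient2_arith)+, simp_all)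
  have w: "\<exists>a b. has_gradient2 w a b x" for x
    unfolding w_def u_def by (intro exI) ((rule has_gradient2_arith)+)
  have L: "has_gradient2 L (F * snd x + (1 / 2) * (B + 2 * E * fst x)) (u x) x" for x
    unfolding L_def by (rule has_gradient2_eqI, (rule has_gradient2_arith u)+, simp_all add: algebra_simps)
  have U0: "w 0 = 4 * A * C - B\<^sup>2" "u 0 = C"
    by (simp_all add: w_def u_def power2_eq_square)
  show ?thesis
  proof (rule that)
    show "local_coordinates X Y"
    proof (rule local_coordinatesI)
      show "open U"
        unfolding U_def w_def u_def
        by (intro open_Collect_conj open_Collect_less open_Collect_neq continuous_intros)
      show "0 \<in> U" using C disc by (simp add: U_def U0)
      show "X 0 = 0" "Y 0 = 0" by (simp_all add: X_def Y_def L_def N_def)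
      fix x assume "x \<in> U"
      then have x: "Re (w x) > 0" "u x \<noteq> 0" by (simp_all add: U_def)
      obtain a b where "has_gradient2 w a b x" using w by blast
      from has_gradient2_comp[OF this csqrt_derivative[OF x(1)]]
      obtain a b where r: "has_gradient2 (\<lambda>x. csqrt (w x)) a b x" by blast
      have N: "has_gradient2 N (\<i> / 2 * (fst x * a + csqrt (w x))) (\<i> / 2 * (fst x * b)) x"
        unfolding N_def by (rule has_gradient2_eqI, (rule has_gradient2_arith r)+, simp_all)
      have v: "has_gradient2 (\<lambda>x. inverse (u x)) (- (F / (u x)\<^sup>2)) 0 x"
        by (rule has_gradient2_eqI, rule has_gradient2_comp[OF u], rule DERIV_inverse[OF x(2)])
          (simp_all add: field_simps power2_eq_square)
      have "has_gradient2 (\<lambda>x. L x + (- 1) * N x)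
          (F * snd x + 1 / 2 * (B + 2 * E * fst x) - \<i> / 2 * (fst x * a + csqrt (w x)))
          (u x - \<i> / 2 * (fst x * b)) x"
        by (rule has_gradient2_eqI, (rule has_gradient2_arith L N)+, simp_all)
      from has_gradient2_mult[OF this v] has_gradient2_add[OF L N]
      have "has_gradient2 X (F * snd x + 1 / 2 * (B + 2 * E * fst x) + \<i> / 2 * (fst x * a + csqrt (w x)))
          (u x + \<i> / 2 * (fst x * b)) x"
        "has_gradient2 Y ((L x + (- 1) * N x) * (- (F / (u x)\<^sup>2))
            + (F * snd x + 1 / 2 * (B + 2 * E * fst x) - \<i> / 2 * (fst x * a + csqrt (w x))) * inverse (u x))
          ((L x + (- 1) * N x) * 0 + (u x - \<i> / 2 * (fst x * b)) * inverse (u x)) x"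
        unfolding X_def[abs_def] Y_def[abs_def] by simp_all
      moreover have "Re (w 0) > 0" using disc by (simp only: U0)
      then have "csqrt (w 0) \<noteq> 0" by auto
      ultimately show "\<exists>a b c d. has_gradient2 X a b x \<and> has_gradient2 Y c d x \<and> (x = 0 \<longrightarrow> a * d - b * c \<noteq> 0)"
        using C by - (intro exI conjI impI, assumption, assumption,
          simp add: U0(2) L_def N_def field_simps)
    qed
    have "open {x. u x \<noteq> 0}" unfolding u_def by (intro open_Collect_neq continuous_intros)
    then have "\<forall>\<^sub>F x in nhds 0. u x \<noteq> 0"
      using eventually_nhds_in_open[of "{x. u x \<noteq> 0}" 0] C by (simp add: U0)
    then show "\<forall>\<^sub>F x :: complex \<times> complex in nhds 0. (case x of (s, t) \<Rightarrow> A * s\<^sup>2 + B * s * t + C * t\<^sup>2 + D * s ^ 3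
        + E * s\<^sup>2 * t + F * s * t\<^sup>2) = X x * Y x"
    proof eventually_elim
      case (elim x)
      obtain s t where st: "x = (s, t)" by (cases x)
      have "X x * Y x = ((L x)\<^sup>2 + (1 / 4) * (s\<^sup>2 * (csqrt (w x))\<^sup>2)) * inverse (u x)"
        by (simp add: X_def Y_def N_def st power2_eq_square algebra_simps add_divide_distrib diff_divide_distrib)
      also have "(csqrt (w x))\<^sup>2 = w x" by simp
      also have "(L x)\<^sup>2 + (1 / 4) * (s\<^sup>2 * w x)
          = (u x * t\<^sup>2 + t * s * (B + E * s) + s\<^sup>2 * (A + D * s)) * u x"
        by (simp add: L_def w_def st power2_eq_square algebra_simps)
      finally have "X x * Y x = u x * t\<^sup>2 + t * s * (B + E * s) + s\<^sup>2 * (A + D * s)"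
        using elim by (simp add: mult.assoc)
      then show ?case by (simp add: st u_def power2_eq_square power3_eq_cube algebra_simps)
    qed
  qed
qed

text \<open>Completing the cube absorbs the terms in \<open>t\<^sup>3\<close> and \<open>s t\<^sup>2\<close>; what remains is \<open>s\<^sup>2\<close> times a unit
  whose constant term has positive real part, hence a square.\<close>

lemma cusp_coordinates:
  fixes A D E F G :: complex
  assumes A: "Re A > 0" and G: "G \<noteq> 0"
  obtains X Y where "local_coordinates X Y"
    "\<forall>\<^sub>F x :: complex \<times> complex in nhds 0. (case x of (s, t) \<Rightarrow> A * s\<^sup>2 + D * s ^ 3 + E * s\<^sup>2 * t + F * s * t\<^sup>2 + G * t ^ 3)
      = (Y x)\<^sup>2 - (X x) ^ 3"
proof -
  define \<beta> where "\<beta> = F / (3 * G)"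
  define \<rho> where "\<rho> = exp (Ln (- G) / 3)"
  have "\<rho> ^ 3 = exp (Ln (- G))" unfolding \<rho>_def by (subst exp_of_nat_mult[symmetric]) simp
  with G have \<rho>: "\<rho> ^ 3 = - G" "\<rho> \<noteq> 0" by (simp_all add: \<rho>_def)
  define w :: "complex \<times> complex \<Rightarrow> complex" where
    "w x = A + (D - G * \<beta> ^ 3) * fst x + (E - 3 * G * \<beta>\<^sup>2) * snd x" for x
  define X :: "complex \<times> complex \<Rightarrow> complex" where "X x = \<rho> * \<beta> * fst x + \<rho> * snd x" for x
  define Y where "Y x = fst x * csqrt (w x)" for x
  define U where "U = {x. Re (w x) > 0}"
  have w: "\<exists>a b. has_gradient2 w a b x" for x
    unfolding w_def by (intro exI) ((rule has_gradient2_arith)+)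
  have X: "has_gradient2 X (\<rho> * \<beta>) \<rho> x" for x
    unfolding X_def by (rule has_gradient2_eqI, (rule has_gradient2_arith)+, simp_all)
  have w0: "w 0 = A" by (simp add: w_def)
  have A': "A \<noteq> 0" using A by auto
  show ?thesis
  proof (rule that)
    show "local_coordinates X Y"
    proof (rule local_coordinatesI)
      show "open U" unfolding U_def w_def by (intro open_Collect_less continuous_intros)
      show "0 \<in> U" using A by (simp add: U_def w0)
      show "X 0 = 0" "Y 0 = 0" by (simp_all add: X_def Y_def)
      fix x assume "x \<in> U"
      then have x: "Re (w x) > 0" by (simp add: U_def)
      obtain a b where "has_gradient2 w a b x" using w by blast
      from has_gradient2_comp[OF this csqrt_derivative[OF x(1)]]
      obtain a b where r: "has_gradient2 (\<lambda>x. csqrt (w x)) a b x" by blast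
      have "has_gradient2 Y (fst x * a + csqrt (w x)) (fst x * b) x"
        unfolding Y_def by (rule has_gradient2_eqI, (rule has_gradient2_arith r)+, simp_all)
      with X[of x] show "\<exists>a b c d. has_gradient2 X a b x \<and> has_gradient2 Y c d x \<and> (x = 0 \<longrightarrow> a * d - b * c \<noteq> 0)"
        using A' \<rho>(2) by - (intro exI conjI impI, assumption, assumption, simp add: w0)
    qed
    have "(case x of (s, t) \<Rightarrow> A * s\<^sup>2 + D * s ^ 3 + E * s\<^sup>2 * t + F * s * t\<^sup>2 + G * t ^ 3)
      = (Y x)\<^sup>2 - (X x) ^ 3" for x :: "complex \<times> complex"
    proof -
      obtain s t where st: "x = (s, t)" by (cases x)
      have F: "F = 3 * G * \<beta>" using G by (simp add: \<beta>_def)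
      have "(X x) ^ 3 = \<rho> ^ 3 * (\<beta> * s + t) ^ 3"
        by (simp add: X_def st power_mult_distrib[symmetric] algebra_simps)
      also note \<rho>(1)
      finally have "(Y x)\<^sup>2 - (X x) ^ 3 = s\<^sup>2 * w x + G * (\<beta> * s + t) ^ 3"
        by (simp add: Y_def st power_mult_distrib)
      then show ?thesis
        by (simp add: st w_def F power2_eq_square power3_eq_cube algebra_simps)
    qed
    then show "\<forall>\<^sub>F x :: complex \<times> complex in nhds 0. (case x of (s, t) \<Rightarrow> A * s\<^sup>2 + D * s ^ 3 + E * s\<^sup>2 * t + F * s * t\<^sup>2 + G * t ^ 3)
      = (Y x)\<^sup>2 - (X x) ^ 3" by simp
  qed
qed


section \<open>The singular point: acnode or cusp\<close>

lemma real_cubic_zero_pos: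
  fixes D E F G :: real
  assumes "D > 0"
  shows "\<exists>x. D * x ^ 3 + E * x\<^sup>2 + F * x + G = 0"
proof -
  define p where "p = [:G, F, E, D:]"
  have p: "poly p x = D * x ^ 3 + E * x\<^sup>2 + F * x + G" for x
    by (simp add: p_def power2_eq_square power3_eq_cube algebra_simps)
  have "lead_coeff p > 0" "lead_coeff [:- G, F, - E, D:] > 0" using assms by (simp_all add: p_def)
  from this[THEN poly_pinfty_gt_lc] obtain m n where
    m: "\<And>x. x \<ge> m \<Longrightarrow> poly p x \<ge> D" and n: "\<And>x. x \<ge> n \<Longrightarrow> poly [:- G, F, - E, D:] x \<ge> D"
    using assms by (auto simp: p_def)
  define b where "b = max 1 (max m n)"
  have "poly [:- G, F, - E, D:] b = - poly p (- b)"
    by (simp add: p_def algebra_simps)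
  moreover have b: "b \<ge> m" "b \<ge> n" "b \<ge> 1" by (simp_all add: b_def)
  ultimately have "poly p (- b) < 0" "poly p b > 0"
    using m[OF b(1)] n[OF b(2)] assms by linarith+
  then obtain x where "poly p x = 0"
    using poly_IVT_pos[of "- b" b p] b(3) by auto
  then show ?thesis using p by metis
qed

lemma real_cubic_zero:
  fixes D E F G :: real
  shows "\<exists>s z. (s \<noteq> 0 \<or> z \<noteq> 0) \<and> D * s ^ 3 + E * s\<^sup>2 * z + F * s * z\<^sup>2 + G * z ^ 3 = 0"
proof (cases "D = 0")
  case True
  then show ?thesis by (intro exI[of _ 1] exI[of _ 0]) simp
next
  case False
  have "\<exists>x. D * x ^ 3 + E * x\<^sup>2 + F * x + G = 0"
  proof (cases "D > 0")
    case True
    then show ?thesis by (rule real_cubic_zero_pos)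
  next
    case neg: False
    then obtain x where "(- D) * x ^ 3 + (- E) * x\<^sup>2 + (- F) * x + (- G) = 0"
      using real_cubic_zero_pos[of "- D" "- E" "- F" "- G"] False by auto
    then have "D * x ^ 3 + E * x\<^sup>2 + F * x + G = 0" by simp
    then show ?thesis by blast
  qed
  then obtain x where "D * x ^ 3 + E * x\<^sup>2 + F * x + G = 0" by blast
  then show ?thesis by (intro exI[of _ x] exI[of _ 1]) simp
qed

text \<open>Determinant divided by trace is a lower bound for the smallest eigenvalue.\<close>

lemma definite_form_bound:
  fixes A B C :: real
  assumes "A > 0" "C > 0" "4 * A * C - B\<^sup>2 > 0"
  shows "\<exists>m>0. \<forall>s z. A * s\<^sup>2 + B * s * z + C * z\<^sup>2 \<ge> m * (s\<^sup>2 + z\<^sup>2)"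
proof (intro exI conjI allI)
  let ?m = "(4 * A * C - B\<^sup>2) / (4 * (A + C))"
  show "?m > 0" using assms by simp
  fix s z :: real
  define m where "m = ?m"
  have "4 * (A + C) \<noteq> 0" using assms by simp
  from nonzero_eq_divide_eq[OF this, THEN iffD1, OF m_def]
  have eq: "4 * m * (A + C) = 4 * A * C - B\<^sup>2" by (simp only: mult_ac)
  have "4 * (m * (A + C)) = 4 * (A * C) - B\<^sup>2" using eq by (simp only: mult_ac)
  then have "m * (A + C) \<le> A * C" using zero_le_power2[of B] by linarith
  also have "\<dots> < A * (A + C)" using assms by (simp add: algebra_simps)
  finally have Am: "A - m > 0" using assms by simp
  have "4 * (A - m) * (A * s\<^sup>2 + B * s * z + C * z\<^sup>2 - m * (s\<^sup>2 + z\<^sup>2))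
      = (2 * (A - m) * s + B * z)\<^sup>2 + (4 * A * C - B\<^sup>2 - 4 * m * (A + C) + 4 * m\<^sup>2) * z\<^sup>2"
    by (simp add: power2_eq_square algebra_simps)
  also have "\<dots> = (2 * (A - m) * s + B * z)\<^sup>2 + 4 * m\<^sup>2 * z\<^sup>2" unfolding eq by simp
  also have "\<dots> \<ge> 0" by simp
  finally have "A * s\<^sup>2 + B * s * z + C * z\<^sup>2 - m * (s\<^sup>2 + z\<^sup>2) \<ge> 0"
    using Am by (simp add: zero_le_mult_iff)
  then show "A * s\<^sup>2 + B * s * z + C * z\<^sup>2 \<ge> ?m * (s\<^sup>2 + z\<^sup>2)" by (simp add: m_def)
qed

lemma binary_cubic_bound:
  fixes D E F G s z :: real
  shows "\<bar>D * s ^ 3 + E * s\<^sup>2 * z + F * s * z\<^sup>2 + G * z ^ 3\<bar>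
    \<le> (\<bar>D\<bar> + \<bar>E\<bar> + \<bar>F\<bar> + \<bar>G\<bar>) * ((\<bar>s\<bar> + \<bar>z\<bar>) * (s\<^sup>2 + z\<^sup>2))"
proof -
  define S Z where "S = \<bar>s\<bar>" and "Z = \<bar>z\<bar>"
  define r where "r = (S + Z) * (S\<^sup>2 + Z\<^sup>2)"
  have nn: "S \<ge> 0" "Z \<ge> 0" by (simp_all add: S_def Z_def)
  have "r = S ^ 3 + S\<^sup>2 * Z + S * Z\<^sup>2 + Z ^ 3"
    by (simp add: r_def power2_eq_square power3_eq_cube algebra_simps)
  moreover have "S ^ 3 \<ge> 0" "S\<^sup>2 * Z \<ge> 0" "S * Z\<^sup>2 \<ge> 0" "Z ^ 3 \<ge> 0" using nn by simp_all
  ultimately have le: "S ^ 3 \<le> r" "S\<^sup>2 * Z \<le> r" "S * Z\<^sup>2 \<le> r" "Z ^ 3 \<le> r" by linarith+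
  have abs: "\<bar>D * s ^ 3\<bar> = \<bar>D\<bar> * S ^ 3" "\<bar>E * s\<^sup>2 * z\<bar> = \<bar>E\<bar> * (S\<^sup>2 * Z)"
    "\<bar>F * s * z\<^sup>2\<bar> = \<bar>F\<bar> * (S * Z\<^sup>2)" "\<bar>G * z ^ 3\<bar> = \<bar>G\<bar> * Z ^ 3"
    unfolding S_def Z_def abs_mult power_abs mult.assoc by (rule refl)+
  from mult_left_mono[OF le(1) abs_ge_zero[of D]] mult_left_mono[OF le(2) abs_ge_zero[of E]]
    mult_left_mono[OF le(3) abs_ge_zero[of F]] mult_left_mono[OF le(4) abs_ge_zero[of G]]
  have "\<bar>D * s ^ 3\<bar> + \<bar>E * s\<^sup>2 * z\<bar> + \<bar>F * s * z\<^sup>2\<bar> + \<bar>G * z ^ 3\<bar>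
      \<le> \<bar>D\<bar> * r + \<bar>E\<bar> * r + \<bar>F\<bar> * r + \<bar>G\<bar> * r"
    unfolding abs by linarith
  then have "\<bar>D * s ^ 3 + E * s\<^sup>2 * z + F * s * z\<^sup>2 + G * z ^ 3\<bar>
      \<le> (\<bar>D\<bar> + \<bar>E\<bar> + \<bar>F\<bar> + \<bar>G\<bar>) * r"
    unfolding distrib_right
    by (intro order_trans[OF _ \<open>_ \<le> \<bar>D\<bar> * r + _ + _ + _\<close>] order_trans[OF abs_triangle_ineq] add_right_mono) auto
  then show ?thesis by (simp add: r_def S_def Z_def)
qed

context singular_cubic
begin

lemma basis_det:
  assumes "x1 * y2 \<noteq> x2 * (y1 :: complex)"
  shows "det (vector [cvec P, x1 *s axis k 1 + x2 *s axis i 1, y1 *s axis k 1 + y2 *s axis i 1] :: complex ^ 3 ^ 3) \<noteq> 0"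
proof -
  have ne: "x1 * y2 - x2 * y1 \<noteq> 0" "x2 * y1 - x1 * y2 \<noteq> 0" using assms by auto
  show ?thesis
    using exhaust_3[of i] exhaust_3[of j] exhaust_3[of k] ijk Pj ne
    by (elim disjE) (simp_all add: det_3 axis_def algebra_simps)
qed

lemma affine_equation_coordinates:
  fixes x1 x2 y1 y2 :: real
  assumes "x1 * y2 \<noteq> x2 * y1"
  defines "a \<equiv> x1 *s axis k 1 + x2 *s axis i 1" and "b \<equiv> y1 *s axis k 1 + y2 *s axis i 1"
  shows "affine_equation (complexify f) (complex_point (abs_proj P)) (\<lambda>(s, r).
     of_real (3 * tri t P a a) * s\<^sup>2 + of_real (6 * tri t P a b) * s * r + of_real (3 * tri t P b b) * r\<^sup>2 +
     (of_real (tri t a a a) * s ^ 3 + of_real (3 * tri t a a b) * s\<^sup>2 * r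
       + of_real (3 * tri t a b b) * s * r\<^sup>2 + of_real (tri t b b b) * r ^ 3))"
proof -
  have "complex_of_real x1 * complex_of_real y2 \<noteq> complex_of_real x2 * complex_of_real y1"
    using assms(1) by (simp flip: of_real_mult)
  from basis_det[OF this] have "det (vector [cvec P, cvec a, cvec b] :: complex ^ 3 ^ 3) \<noteq> 0"
    by (simp add: a_def b_def cvec_add cvec_scale cvec_axis)
  moreover have "poly_eval (complexify f) (cvec P + s *s cvec a + u *s cvec b) =
     of_real (3 * tri t P a a) * s\<^sup>2 + of_real (6 * tri t P a b) * s * u + of_real (3 * tri t P b b) * u\<^sup>2 +
     (of_real (tri t a a a) * s ^ 3 + of_real (3 * tri t a a b) * s\<^sup>2 * u
       + of_real (3 * tri t a b b) * s * u\<^sup>2 + of_real (tri t b b b) * u ^ 3)" for s u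
    using eval_coordinates[of 1 s a u b] by simp
  ultimately show ?thesis
    unfolding affine_equation_def complex_point_abs_proj[OF P_nonzero]
    by (intro exI[of _ "cvec P"] exI[of _ "cvec a"] exI[of _ "cvec b"]) (simp add: fun_eq_iff)
qed

lemma qf_tri: "qf s z = 3 * tri t P (s *s axis k 1 + z *s axis i 1) (s *s axis k 1 + z *s axis i 1)"
  for s z :: real
  using tri_polar[OF sym, of P 0 s "axis k 1" z "axis i 1"] by (simp add: qf_def)

lemma kf_tri: "kf s z = tri t (s *s axis k 1 + z *s axis i 1) (s *s axis k 1 + z *s axis i 1) (s *s axis k 1 + z *s axis i 1)"
  for s z :: real
  using tri_expand[OF sym, of 0 P s "axis k 1" z "axis i 1"] by (simp add: kf_def)

text \<open>Near \<open>P\<close> a definite quadratic part outweighs the cubic part.  This isolates \<open>P\<close> in the real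
  curve, and it bounds forms that vanish to second order at \<open>P\<close>.\<close>

lemma definite_lower_bound:
  assumes pos: "\<And>s z :: real. s \<noteq> 0 \<or> z \<noteq> 0 \<Longrightarrow> qf s z > 0"
  obtains \<epsilon> \<delta> where "\<epsilon> > 0" "\<delta> > 0"
    "\<And>y s z :: real. y > 0 \<Longrightarrow> \<bar>s\<bar> + \<bar>z\<bar> \<le> \<epsilon> * y \<Longrightarrow> y * qf s z + kf s z \<ge> \<delta> * y * (s\<^sup>2 + z\<^sup>2)"
proof -
  let ?A = "3 * tri t P (axis k 1) (axis k 1)" and ?B = "6 * tri t P (axis k 1) (axis i 1)"
    and ?C = "3 * tri t P (axis i 1) (axis i 1)"
  have q: "qf s z = ?A * s\<^sup>2 + ?B * s * z + ?C * z\<^sup>2" for s z :: real by (simp add: qf_def)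
  have A: "?A > 0" and C: "?C > 0" using pos[of 1 0] pos[of 0 1] by (simp_all add: q)
  have "0 < qf (- ?B) (2 * ?A)" using A by (intro pos) simp
  also have "\<dots> = ?A * (4 * ?A * ?C - ?B\<^sup>2)" unfolding q by (simp add: power2_eq_square algebra_simps)
  finally have "4 * ?A * ?C - ?B\<^sup>2 > 0" using A by (simp add: zero_less_mult_iff)
  from definite_form_bound[OF A C this] obtain m where
    m: "m > 0" "\<And>s z :: real. qf s z \<ge> m * (s\<^sup>2 + z\<^sup>2)" unfolding q by blast
  obtain K where K: "K \<ge> 0" "\<And>s z :: real. \<bar>kf s z\<bar> \<le> K * ((\<bar>s\<bar> + \<bar>z\<bar>) * (s\<^sup>2 + z\<^sup>2))"
    using binary_cubic_bound unfolding kf_def by (simp del: of_real_mult) (metis abs_ge_zero add_nonneg_nonneg)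
  show ?thesis
  proof (rule that[of "m / (2 * K + 1)" "m / 2"])
    show "m / (2 * K + 1) > 0" "m / 2 > 0" using m K by simp_all
    fix y s z :: real
    assume y: "y > 0" "\<bar>s\<bar> + \<bar>z\<bar> \<le> m / (2 * K + 1) * y"
    have "K * (\<bar>s\<bar> + \<bar>z\<bar>) \<le> K * (m / (2 * K + 1) * y)" using y K by (intro mult_left_mono)
    also have "\<dots> = K / (2 * K + 1) * (m * y)" by simp
    also have "\<dots> \<le> 1 / 2 * (m * y)" using K m y by (intro mult_right_mono) (simp_all add: field_simps)
    finally have "K * (\<bar>s\<bar> + \<bar>z\<bar>) * (s\<^sup>2 + z\<^sup>2) \<le> m / 2 * y * (s\<^sup>2 + z\<^sup>2)"
      by (intro mult_right_mono) simp_all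
    moreover have "y * qf s z \<ge> y * (m * (s\<^sup>2 + z\<^sup>2))" using m y by (intro mult_left_mono) simp_all
    moreover have "\<bar>kf s z\<bar> \<le> K * (\<bar>s\<bar> + \<bar>z\<bar>) * (s\<^sup>2 + z\<^sup>2)" using K(2)[of s z] by (simp add: mult.assoc)
    ultimately show "y * qf s z + kf s z \<ge> m / 2 * y * (s\<^sup>2 + z\<^sup>2)"
      by (simp add: algebra_simps)
  qed
qed

text \<open>A real zero of \<open>k\<close> is a direction \<open>b\<close> for which the equation in the coordinates along \<open>a\<close>, \<open>b\<close> has
  degree 2 in the second coordinate.\<close>

lemma acnode_P:
  assumes pos: "\<And>s z :: real. s \<noteq> 0 \<or> z \<noteq> 0 \<Longrightarrow> qf s z > 0"
  shows "acnode f (abs_proj P)"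
  unfolding acnode_def
proof
  obtain y1 y2 :: real where y: "y1 \<noteq> 0 \<or> y2 \<noteq> 0" "kf y1 y2 = 0"
    using real_cubic_zero unfolding kf_def of_real_eq_id id_apply by metis
  define a b :: "real ^ 3" where "a = y2 *s axis k 1 + (- y1) *s axis i 1"
    and "b = y1 *s axis k 1 + y2 *s axis i 1"
  have T: "3 * tri t P a a > 0" "3 * tri t P b b > 0" "tri t b b b = 0"
    using pos[of y2 "- y1"] pos[of y1 y2] y qf_tri[of y2 "- y1"] qf_tri[of y1 y2] kf_tri[of y1 y2]
    unfolding a_def b_def by auto
  have "y1\<^sup>2 + y2\<^sup>2 \<noteq> 0" using y by (simp add: sum_power2_eq_zero_iff)
  then have ne: "y2 * y2 \<noteq> - y1 * y1" by (simp add: power2_eq_square eq_neg_iff_add_eq_0 add.commute)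
  \<comment> \<open>up to a factor, the component of \<open>a\<close> orthogonal to \<open>b\<close> for the quadratic part, whose value there is
    a multiple of the discriminant\<close>
  define u where "u = tri t P b b *s a + (- tri t P a b) *s b"
  have u: "u = (tri t P b b * y2 - tri t P a b * y1) *s axis k 1 + (- tri t P b b * y1 - tri t P a b * y2) *s axis i 1"
    by (simp add: u_def a_def b_def vec_eq_iff algebra_simps)
  have "tri t P b b * y2 - tri t P a b * y1 \<noteq> 0 \<or> - tri t P b b * y1 - tri t P a b * y2 \<noteq> 0"
  proof (rule ccontr)
    assume "\<not> ?thesis"
    then have "(tri t P b b * y2 - tri t P a b * y1) * y2 - (- tri t P b b * y1 - tri t P a b * y2) * y1 = 0"
      by simp
    then have "tri t P b b * (y1\<^sup>2 + y2\<^sup>2) = 0" by (simp add: power2_eq_square algebra_simps)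
    then show False using T \<open>y1\<^sup>2 + y2\<^sup>2 \<noteq> 0\<close> by simp
  qed
  from pos[OF this] have "0 < tri t P u u" unfolding qf_tri u by simp
  also have "\<dots> = tri t P b b * (tri t P b b * tri t P a a - (tri t P a b)\<^sup>2)"
    using tri_polar[OF sym, of P 0 "tri t P b b" a "- tri t P a b" b]
    by (simp add: u_def power2_eq_square algebra_simps)
  finally have "tri t P b b * tri t P a a - (tri t P a b)\<^sup>2 > 0" using T by (simp add: zero_less_mult_iff)
  then have "4 * (3 * tri t P a a) * (3 * tri t P b b) - (6 * tri t P a b)\<^sup>2 > 0"
    by (simp add: power2_eq_square algebra_simps)
  then have disc: "Re (4 * of_real (3 * tri t P a a) * of_real (3 * tri t P b b) - (of_real (6 * tri t P a b))\<^sup>2) > 0"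
    by (simp add: power2_eq_square algebra_simps)
  have "complex_of_real (3 * tri t P b b) \<noteq> 0" using T by simp
  then show "node (complexify f) (complex_point (abs_proj P))"
  proof (rule node_coordinates[OF _ disc, where D = "of_real (tri t a a a)"
        and E = "of_real (3 * tri t a a b)" and F = "of_real (3 * tri t a b b)"])
    fix X Y assume "local_coordinates X Y" and
      "\<forall>\<^sub>F x :: complex \<times> complex in nhds 0. (case x of (s, r) \<Rightarrow>
         of_real (3 * tri t P a a) * s\<^sup>2 + of_real (6 * tri t P a b) * s * r
         + of_real (3 * tri t P b b) * r\<^sup>2 + of_real (tri t a a a) * s ^ 3
         + of_real (3 * tri t a a b) * s\<^sup>2 * r + of_real (3 * tri t a b b) * s * r\<^sup>2) = X x * Y x"
    then show ?thesis
      unfolding node_def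
      using affine_equation_coordinates[of y2 y2 "- y1" y1, OF ne, folded a_def b_def]
      by - (intro exI conjI, assumption, assumption, simp add: T(3) add.assoc)
  qed
next
  obtain \<epsilon> \<delta> where ed: "\<epsilon> > 0" "\<delta> > 0"
    "\<And>y s z :: real. y > 0 \<Longrightarrow> \<bar>s\<bar> + \<bar>z\<bar> \<le> \<epsilon> * y \<Longrightarrow> y * qf s z + kf s z \<ge> \<delta> * y * (s\<^sup>2 + z\<^sup>2)"
    using definite_lower_bound[OF pos] by blast
  define c where "c v \<longleftrightarrow> \<bar>v $ k - P $ k * v $ j\<bar> + \<bar>v $ i - P $ i * v $ j\<bar> < \<epsilon> * \<bar>v $ j\<bar>" for v :: "real ^ 3"
  have nonzero: "v \<noteq> 0" if "c v" for v using that by (auto simp: c_def)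
  have scale: "c (r *s v)" if "c v" "r \<noteq> 0" for r v
  proof -
    have "\<bar>r\<bar> * (\<bar>v $ k - P $ k * v $ j\<bar> + \<bar>v $ i - P $ i * v $ j\<bar>) < \<bar>r\<bar> * (\<epsilon> * \<bar>v $ j\<bar>)"
      using that by (intro mult_strict_left_mono) (auto simp: c_def)
    then show ?thesis by (simp add: c_def algebra_simps flip: abs_mult)
  qed
  define T where "T = {abs_proj v | v. c v}"
  have "{v. v \<noteq> 0 \<and> abs_proj v \<in> T} = {v. c v}"
  proof (intro set_eqI iffI; clarsimp)
    fix v :: "real ^ 3" assume v: "v \<noteq> 0" "abs_proj v \<in> T"
    then obtain w where w: "abs_proj v = abs_proj w" "c w" by (auto simp: T_def)
    then obtain r where "v = r *s w" using abs_proj_eq_iff[of w v] nonzero v by auto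
    with v w scale show "c v" by auto
  next
    fix v assume "c v"
    then show "v \<noteq> 0 \<and> abs_proj v \<in> T" using nonzero by (auto simp: T_def)
  qed
  moreover have "open {v. c v}" unfolding c_def by (intro open_Collect_less continuous_intros)
  ultimately have "open T" unfolding open_proj_def by simp
  have cP: "c P" using Pj ed by (simp add: c_def)
  have V: "abs_proj v \<in> V_real f \<longleftrightarrow> tri t v v v = 0" if "v \<noteq> 0" for v
    unfolding V_real_def using that hom by (subst abs_proj_in_zeros_iff) (auto simp: real_eval)
  have pos_case: "v = v $ j *s P" if "c v" "v $ j > 0" "poly_eval f v = 0" for v
  proof -
    let ?s = "v $ k - P $ k * v $ j" and ?z = "v $ i - P $ i * v $ j"
    note vc = coordinates[OF Pj, of v]
    have "v $ j * qf ?s ?z + kf ?s ?z = 0"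
      using that(3) arg_cong[OF vc, of "poly_eval f"] unfolding real_eval_qf_kf by simp
    with ed(3)[of "v $ j" ?s ?z] that have "\<delta> * v $ j * (?s\<^sup>2 + ?z\<^sup>2) \<le> 0" by (auto simp: c_def)
    with ed that have "?s\<^sup>2 + ?z\<^sup>2 \<le> 0" by (simp add: mult_le_0_iff)
    then have sz: "?s = 0" "?z = 0" by (simp_all add: sum_power2_le_zero_iff)
    note vc
    also have "v $ j *s P + ?s *s axis k 1 + ?z *s axis i 1 = v $ j *s P"
      unfolding sz by simp
    finally show ?thesis .
  qed
  have "x = abs_proj P" if x: "x \<in> T" "x \<in> V_real f" for x
  proof -
    obtain v where v: "x = abs_proj v" "c v" using x by (auto simp: T_def)
    have f0: "poly_eval f v = 0" using x v V nonzero by (simp add: real_eval)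
    have "v $ j \<noteq> 0" using v ed by (auto simp: c_def)
    then consider "v $ j > 0" | "v $ j < 0" by linarith
    then have "v = v $ j *s P"
    proof cases
      case 1
      with pos_case v f0 show ?thesis by blast
    next
      case 2
      have "v = (- 1) *s ((- 1) *s v)" by (simp add: vector_smult_assoc)
      also have "(- 1) *s v = ((- 1) *s v) $ j *s P"
      proof (rule pos_case)
        show "c ((- 1) *s v)" by (rule scale[OF v(2)]) simp
        show "((- 1) *s v) $ j > 0" using 2 by simp
        show "poly_eval f ((- 1) *s v) = 0" using f0 poly_eval_homogeneous[OF hom, of "- 1" v] by simp
      qed
      also have "(- 1) *s (((- 1) *s v) $ j *s P) = v $ j *s P" by (simp add: vector_smult_assoc)
      finally show ?thesis .
    qed
    then have "abs_proj (v $ j *s P) = x" using v by simp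
    then show ?thesis using \<open>v $ j \<noteq> 0\<close> P_nonzero by (simp add: abs_proj_scale)
  qed
  moreover have "abs_proj P \<in> T" unfolding T_def using cP by blast
  moreover have "abs_proj P \<in> V_real f" using V[OF P_nonzero] sing by simp
  ultimately show "abs_proj P isolated_in V_real f"
    unfolding isolated_in_def using \<open>open T\<close> by blast
qed

text \<open>The null direction \<open>b\<close> of \<open>q\<close> is the tangent of the cusp: semidefiniteness removes the mixed term, and
  \<open>k(b)\<close> is the coefficient that does not vanish.\<close>

lemma cusp_P:
  assumes A: "qf 1 0 > (0 :: real)" and psd: "\<And>s z :: real. qf s z \<ge> 0"
    and y: "y1 \<noteq> 0 \<or> y2 \<noteq> 0" "qf y1 y2 = (0 :: real)"
  shows "cusp (complexify f) (complex_point (abs_proj P))"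
proof -
  define a b :: "real ^ 3" where "a = 1 *s axis k 1 + 0 *s axis i 1"
    and "b = y1 *s axis k 1 + y2 *s axis i 1"
  have "y2 \<noteq> 0"
  proof
    assume "y2 = 0"
    then have "qf y1 y2 = y1\<^sup>2 * qf 1 (0 :: real)" using qf_scale[of y1 1 0] by simp
    with y A \<open>y2 = 0\<close> show False by simp
  qed
  then have ne: "1 * y2 \<noteq> 0 * y1" by simp
  have T: "3 * tri t P a a > 0" "tri t P b b = 0" "tri t b b b \<noteq> 0"
    using A y no_real_common_zero[of y1 y2] unfolding qf_tri kf_tri a_def[symmetric] b_def[symmetric] by auto
  have "tri t P a b = 0"
  proof (rule ccontr)
    assume ab: "tri t P a b \<noteq> 0"
    define r where "r = - tri t P a b / tri t P a a"
    have "r *s a + 1 *s b = (r + y1) *s axis k 1 + y2 *s axis i 1"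
      by (simp add: a_def b_def vec_eq_iff algebra_simps)
    then have "0 \<le> tri t P (r *s a + 1 *s b) (r *s a + 1 *s b)"
      using psd[of "r + y1" y2] by (simp add: qf_tri)
    also have "\<dots> = tri t P a a * r\<^sup>2 + 2 * tri t P a b * r"
      using tri_polar[OF sym, of P 0 r a 1 b] T by simp
    also have "\<dots> = - (tri t P a b)\<^sup>2 / tri t P a a"
      using T by (simp add: r_def field_simps power2_eq_square)
    also have "\<dots> < 0" using T ab by (simp add: divide_less_0_iff)
    finally show False by simp
  qed
  have "Re (of_real (3 * tri t P a a)) > 0" "complex_of_real (tri t b b b) \<noteq> 0" using T by simp_all
  then show ?thesis
  proof (rule cusp_coordinates[where D = "of_real (tri t a a a)"
        and E = "of_real (3 * tri t a a b)" and F = "of_real (3 * tri t a b b)"])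
    fix X Y assume "local_coordinates X Y" and
      "\<forall>\<^sub>F x :: complex \<times> complex in nhds 0. (case x of (s, r) \<Rightarrow>
         of_real (3 * tri t P a a) * s\<^sup>2 + of_real (tri t a a a) * s ^ 3
         + of_real (3 * tri t a a b) * s\<^sup>2 * r + of_real (3 * tri t a b b) * s * r\<^sup>2
         + of_real (tri t b b b) * r ^ 3) = (Y x)\<^sup>2 - (X x) ^ 3"
    then show ?thesis
      unfolding cusp_def
      using affine_equation_coordinates[of 1 y2 0 y1, OF ne, folded a_def b_def]
      by - (intro exI conjI, assumption, assumption,
          simp add: T(2) \<open>tri t P a b = 0\<close> add.assoc)
  qed
qed

end


section \<open>Forms dominated by an extremal cubic\<close>

definition nonneg :: "real ^ 3 \<Rightarrow> bool" where
  "nonneg v \<longleftrightarrow> (\<forall>l. v $ l \<ge> 0)"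

text \<open>If \<open>a b \<le> C f\<close> on the orthant, then \<open>f\<close> is the sum of \<open>a b / C\<close> and a copositive form, and
  extremality turns the factorization of \<open>a b\<close> into one of \<open>f\<close>.\<close>

lemma extremal_no_minorant:
  fixes f a b :: "(3, real) mpoly"
  assumes ext: "f \<in> extremal P33_plus" and irr: "irreducible f"
    and ab: "homogeneous 3 (a * b)" "poly_eval a 0 = 0" "poly_eval b 0 = 0"
    and u: "poly_eval (a * b) u \<noteq> 0"
    and pos: "\<And>v. nonneg v \<Longrightarrow> poly_eval (a * b) v \<ge> 0"
    and le: "\<And>v. nonneg v \<Longrightarrow> poly_eval (a * b) v \<le> C * poly_eval f v"
  shows False
proof -
  have f: "homogeneous 3 f" "\<And>v. nonneg v \<Longrightarrow> poly_eval f v \<ge> 0"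
    using ext by (auto simp: extremal_def P33_plus_def nonneg_def)
  define D where "D = max 1 C"
  have D: "D > 0" by (simp add: D_def)
  define g where "g = poly_const (1 / D) * (a * b)"
  have "poly_eval g v \<le> poly_eval f v" if "nonneg v" for v
  proof -
    have "C * poly_eval f v \<le> D * poly_eval f v"
      using f(2)[OF that] by (intro mult_right_mono) (simp_all add: D_def)
    then have "poly_eval (a * b) v \<le> D * poly_eval f v" using le[OF that] by linarith
    then show ?thesis using D by (simp add: g_def field_simps)
  qed
  moreover have "homogeneous 3 g" unfolding g_def using ab(1) by (rule homogeneous_const_mult)
  moreover have "poly_eval g v \<ge> 0" if "nonneg v" for v
    using pos[OF that] D by (simp add: g_def)
  ultimately have "g \<in> P33_plus" "f - g \<in> P33_plus"
    using f(1) by (auto simp: P33_plus_def nonneg_def)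
  moreover have "f = g + (f - g)" by simp
  ultimately obtain \<alpha> where \<alpha>: "g = poly_const \<alpha> * f" using ext unfolding extremal_def by blast
  have "poly_eval g u \<noteq> 0" using u D by (simp add: g_def)
  then have "\<alpha> \<noteq> 0" using \<alpha> by auto
  have const_mult: "poly_const x * poly_const y = (poly_const (x * y) :: (3, real) mpoly)" for x y
    by (simp add: poly_const_def mult_single)
  have "f = poly_const (1 / \<alpha>) * (poly_const \<alpha> * f)"
    unfolding mult.assoc[symmetric] const_mult using \<open>\<alpha> \<noteq> 0\<close> by (simp add: poly_const_def)
  also have "\<dots> = (poly_const (1 / \<alpha>) * poly_const (1 / D) * a) * b"
    unfolding \<alpha>[symmetric] g_def by (simp add: mult.assoc)
  finally show False
    by (rule not_irreducible_product[OF irr]) (simp_all add: ab)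
qed

text \<open>By homogeneity it suffices to compare both functions on the part of the unit sphere that lies in
  the orthant, which is compact.\<close>

lemma local_to_global:
  fixes f g :: "real ^ 3 \<Rightarrow> real"
  assumes hom: "\<And>c v. f (c *s v) = c ^ 3 * f v" "\<And>c v. g (c *s v) = c ^ 3 * g v"
    and f0: "\<And>v. nonneg v \<Longrightarrow> f v \<ge> 0"
    and loc: "\<And>v. nonneg v \<Longrightarrow> v \<noteq> 0 \<Longrightarrow> \<exists>C. \<forall>\<^sub>F w in nhds v. nonneg w \<longrightarrow> g w \<le> C * f w"
  shows "\<exists>C. \<forall>w. nonneg w \<longrightarrow> g w \<le> C * f w"
proof -
  define Q where "Q A \<longleftrightarrow> (\<exists>C. \<forall>w\<in>A. nonneg w \<longrightarrow> g w \<le> C * f w)" for A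
  define S where "S = {v. nonneg v} \<inter> sphere 0 1"
  have Q_Union: "Q (\<Union>T)" if "finite T" "\<forall>A\<in>T. Q A" for T
    using that
  proof (induction T rule: finite_induct)
    case empty
    then show ?case by (simp add: Q_def)
  next
    case (insert A T)
    then obtain C D where C: "\<forall>w\<in>A. nonneg w \<longrightarrow> g w \<le> C * f w"
      and D: "\<forall>w\<in>\<Union>T. nonneg w \<longrightarrow> g w \<le> D * f w" by (auto simp: Q_def)
    have "g w \<le> max C D * f w" if "w \<in> \<Union>(insert A T)" "nonneg w" for w
    proof -
      have "C * f w \<le> max C D * f w" "D * f w \<le> max C D * f w"
        using f0[OF that(2)] by (intro mult_right_mono; simp)+
      moreover have "g w \<le> C * f w \<or> g w \<le> D * f w" using that C D by blast
      ultimately show ?thesis by linarith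
    qed
    then show ?case unfolding Q_def by blast
  qed
  have "closed {v. nonneg v}" unfolding nonneg_def
    by (intro closed_Collect_all closed_Collect_le continuous_intros)
  then have "compact S" unfolding S_def by (intro closed_Int_compact) simp_all
  moreover have "S \<subseteq> \<Union>{U. open U \<and> Q U}"
  proof
    fix v assume "v \<in> S"
    then have "nonneg v" "v \<noteq> 0" by (auto simp: S_def)
    from loc[OF this] obtain C where "\<forall>\<^sub>F w in nhds v. nonneg w \<longrightarrow> g w \<le> C * f w" by blast
    then obtain U where "open U" "v \<in> U" "\<forall>w\<in>U. nonneg w \<longrightarrow> g w \<le> C * f w"
      unfolding eventually_nhds by blast
    then show "v \<in> \<Union>{U. open U \<and> Q U}" unfolding Q_def by blast
  qed
  ultimately obtain T where T: "T \<subseteq> {U. open U \<and> Q U}" "finite T" "S \<subseteq> \<Union>T"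
    by (rule compactE) auto
  then have "Q (\<Union>T)" by (intro Q_Union) auto
  then obtain C where C: "\<forall>w\<in>\<Union>T. nonneg w \<longrightarrow> g w \<le> C * f w" by (auto simp: Q_def)
  have "g w \<le> C * f w" if w: "nonneg w" for w
  proof (cases "w = 0")
    case True
    then show ?thesis using hom[of 0 w] by simp
  next
    case False
    define r where "r = norm w"
    define v where "v = (1 / r) *s w"
    have r: "r > 0" using False by (simp add: r_def)
    have wv: "w = r *s v" using r by (simp add: v_def vector_smult_assoc)
    have "nonneg v" using w r by (simp add: v_def nonneg_def)
    moreover have "norm v = 1" using r by (simp add: v_def scalar_mult_eq_scaleR r_def)
    ultimately have "v \<in> \<Union>T" using T(3) by (auto simp: S_def)
    with C \<open>nonneg v\<close> have "g v \<le> C * f v" by blast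
    then have "r ^ 3 * g v \<le> r ^ 3 * (C * f v)" using r by (intro mult_left_mono) simp_all
    then show ?thesis unfolding wv hom by (simp add: mult_ac)
  qed
  then show ?thesis by blast
qed


section \<open>Zeros of a copositive cubic\<close>

lemma continuous_tri:
  assumes "\<And>x. continuous_on UNIV (\<lambda>w. a w $ x)" "\<And>x. continuous_on UNIV (\<lambda>w. b w $ x)"
    "\<And>x. continuous_on UNIV (\<lambda>w. c w $ x)"
  shows "continuous_on UNIV (\<lambda>w. tri t (a w) (b w) (c w :: real ^ 3))"
  unfolding tri_def by (intro continuous_intros assms)

lemma eventually_less_of_continuous:
  fixes h :: "'a::topological_space \<Rightarrow> real"
  assumes "continuous_on UNIV h" "h v < c"
  shows "\<forall>\<^sub>F w in nhds v. h w < c"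
  using eventually_nhds_in_open[of "{w. h w < c}" v] assms
  by (simp add: open_Collect_less)

lemma constant_term_nonneg:
  fixes b c d :: real
  assumes "\<forall>\<^sub>F e in at_right 0. 0 \<le> b + c * e + d * e\<^sup>2"
  shows "b \<ge> 0"
proof (rule tendsto_lowerbound[OF _ assms])
  show "((\<lambda>e. b + c * e + d * e\<^sup>2) \<longlongrightarrow> b) (at_right 0)"
    by (auto intro!: tendsto_eq_intros)
qed simp

definition feasible :: "real ^ 3 \<Rightarrow> real ^ 3 \<Rightarrow> bool" where
  "feasible p w \<longleftrightarrow> (\<forall>l. p $ l > 0 \<or> p $ l = 0 \<and> w $ l \<ge> 0)"

lemma feasible_nonneg:
  assumes "feasible p w"
  shows "\<forall>\<^sub>F e in at_right 0. nonneg (p + e *s w)"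
  unfolding nonneg_def
proof (rule eventually_all_finite)
  fix l
  consider "p $ l > 0" | "p $ l = 0" "w $ l \<ge> 0" using assms by (auto simp: feasible_def)
  then show "\<forall>\<^sub>F e in at_right 0. 0 \<le> (p + e *s w) $ l"
  proof cases
    case 1
    have "((\<lambda>e. p $ l + e * w $ l) \<longlongrightarrow> p $ l) (at_right 0)"
      by (auto intro!: tendsto_eq_intros)
    then have "\<forall>\<^sub>F e in at_right 0. 0 < p $ l + e * w $ l"
      using 1 by (rule order_tendstoD)
    then show ?thesis by eventually_elim simp
  next
    case 2
    have "\<forall>\<^sub>F e :: real in at_right 0. e > 0" by (rule eventually_at_right_less)
    then show ?thesis by eventually_elim (use 2 in simp)
  qed
qed

locale copositive_cubic =
  fixes t :: "3 \<Rightarrow> 3 \<Rightarrow> 3 \<Rightarrow> real"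
  assumes sym: "sym3 t" and cop: "\<And>v. nonneg v \<Longrightarrow> tri t v v v \<ge> 0"
begin

lemma along_ray:
  assumes "feasible p w"
  shows "\<forall>\<^sub>F e in at_right 0. 0 \<le> tri t p p p + 3 * e * tri t p p w + 3 * e\<^sup>2 * tri t p w w + e ^ 3 * tri t w w w"
  using feasible_nonneg[OF assms]
proof eventually_elim
  case (elim e)
  then have "0 \<le> tri t (p + e *s w) (p + e *s w) (p + e *s w)" by (rule cop)
  then show ?case using tri_expand[OF sym, of 1 p e w 0 0] by (simp add: mult_ac)
qed

lemma first_order:
  assumes "feasible p w" "tri t p p p = 0"
  shows "tri t p p w \<ge> 0"
proof -
  have "\<forall>\<^sub>F e in at_right 0. 0 \<le> 3 * tri t p p w + 3 * tri t p w w * e + tri t w w w * e\<^sup>2"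
    using along_ray[OF assms(1)] eventually_at_right_less[of 0]
  proof eventually_elim
    case (elim e)
    then have "0 \<le> e * (3 * tri t p p w + 3 * tri t p w w * e + tri t w w w * e\<^sup>2)"
      using assms(2) by (simp add: algebra_simps power2_eq_square power3_eq_cube)
    with elim(2) show ?case by (simp only: zero_le_mult_iff) auto
  qed
  then show ?thesis by (drule_tac constant_term_nonneg) simp
qed

lemma second_order:
  assumes "feasible p w" "tri t p p p = 0" "tri t p p w = 0"
  shows "tri t p w w \<ge> 0"
proof -
  have "\<forall>\<^sub>F e in at_right 0. 0 \<le> 3 * tri t p w w + tri t w w w * e + 0 * e\<^sup>2"
    using along_ray[OF assms(1)] eventually_at_right_less[of 0]
  proof eventually_elim
    case (elim e)
    then have "0 \<le> e\<^sup>2 * (3 * tri t p w w + tri t w w w * e + 0 * e\<^sup>2)"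
      using assms(2,3) by (simp add: algebra_simps power2_eq_square power3_eq_cube)
    with elim(2) show ?case by (simp only: zero_le_mult_iff) auto
  qed
  then show ?thesis by (drule_tac constant_term_nonneg) simp
qed

lemma third_order:
  assumes "feasible p w" "tri t p p p = 0" "tri t p p w = 0" "tri t p w w = 0"
  shows "tri t w w w \<ge> 0"
proof -
  have "\<forall>\<^sub>F e in at_right 0. 0 \<le> tri t w w w + 0 * e + 0 * e\<^sup>2"
    using along_ray[OF assms(1)] eventually_at_right_less[of 0]
  proof eventually_elim
    case (elim e)
    then have "0 \<le> e ^ 3 * (tri t w w w + 0 * e + 0 * e\<^sup>2)"
      using assms(2-4) by (simp add: algebra_simps)
    with elim(2) show ?case by (simp only: zero_le_mult_iff) auto
  qed
  then show ?thesis by (drule_tac constant_term_nonneg) simp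
qed

lemma third_order_zero:
  assumes "feasible p w" "feasible p (- w)" "tri t p p p = 0" "tri t p p w = 0" "tri t p w w = 0"
  shows "tri t w w w = 0"
  using third_order[of p w] third_order[of p "- w"] assms by (simp add: tri_uminus)

lemma gradient_nonneg:
  assumes "nonneg v" "tri t v v v = 0"
  shows "tri t v v (axis l 1) \<ge> 0" and "v $ l > 0 \<Longrightarrow> tri t v v (axis l 1) = 0"
proof -
  have "v $ m > 0 \<or> v $ m = 0" for m using assms(1) by (auto simp: nonneg_def less_le)
  then have "feasible v (axis l 1)" "v $ l > 0 \<Longrightarrow> feasible v (- axis l 1)"
    by (auto simp: feasible_def axis_def)
  from this[THEN first_order] assms(2) show "tri t v v (axis l 1) \<ge> 0"
    "v $ l > 0 \<Longrightarrow> tri t v v (axis l 1) = 0"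
    by (simp_all add: tri_uminus order_antisym)
qed

text \<open>A zero is a minimum on the orthant, so a partial derivative that does not vanish is positive and
  belongs to a vanishing coordinate.\<close>

lemma nonsingular_zero:
  assumes "nonneg v" "tri t v v v = 0" "tri t v v u \<noteq> 0"
  obtains l where "v $ l = 0" "tri t v v (axis l 1) > 0"
proof -
  have "\<exists>l. tri t v v (axis l 1) \<noteq> 0"
    using tri_eq_0_if_axis[of t v v u] assms(3) by blast
  then obtain l where l: "tri t v v (axis l 1) \<noteq> 0" by blast
  with gradient_nonneg[OF assms(1,2), of l] assms(1) have "v $ l = 0" "tri t v v (axis l 1) > 0"
    by (auto simp: nonneg_def less_le)
  then show ?thesis by (rule that)
qed

text \<open>Expansion in the direction \<open>e\<^sub>l\<close>: near \<open>v\<close> the coefficient of \<open>w\<^sub>l\<close> stays positive.\<close>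

lemma linear_growth:
  assumes "v $ l = 0" "tri t v v (axis l 1) > 0"
  obtains c where "c > 0" "\<forall>\<^sub>F w in nhds v. nonneg w \<longrightarrow>
    tri t w w w \<ge> tri t (w - w $ l *s axis l 1) (w - w $ l *s axis l 1) (w - w $ l *s axis l 1) + c * w $ l"
proof -
  let ?e = "axis l 1 :: real ^ 3"
  define z where "z w = w - w $ l *s ?e" for w
  define h where "h w = - (3 * tri t (z w) (z w) ?e + 3 * w $ l * tri t (z w) ?e ?e + (w $ l)\<^sup>2 * tri t ?e ?e ?e)" for w
  define c where "c = tri t v v ?e"
  have z: "continuous_on UNIV z"
    unfolding z_def scalar_mult_eq_scaleR by (intro continuous_intros)
  have "continuous_on UNIV h"
    unfolding h_def by (intro continuous_intros continuous_tri z)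
  moreover have "z v = v" using assms by (simp add: z_def)
  then have "h v < - c" using assms by (simp add: h_def c_def)
  ultimately have "\<forall>\<^sub>F w in nhds v. h w < - c" by (rule eventually_less_of_continuous)
  then have "\<forall>\<^sub>F w in nhds v. nonneg w \<longrightarrow> tri t w w w \<ge> tri t (z w) (z w) (z w) + c * w $ l"
  proof eventually_elim
    case (elim w)
    have w: "1 *s z w + w $ l *s ?e + 0 *s 0 = w" by (simp add: z_def)
    have "tri t w w w = tri t (z w) (z w) (z w) + w $ l * (- h w)"
      using tri_expand[OF sym, of 1 "z w" "w $ l" ?e 0 0] unfolding w
      by (simp add: h_def algebra_simps power2_eq_square power3_eq_cube)
    moreover have "w $ l * (- h w) \<ge> w $ l * c" if "nonneg w"
      using elim that by (intro mult_left_mono) (auto simp: nonneg_def)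
    ultimately show ?case by (simp add: mult.commute)
  qed
  then show ?thesis using that[of c] assms unfolding z_def c_def by blast
qed

lemma nonneg_drop: "nonneg w \<Longrightarrow> nonneg (w - w $ l *s axis l 1)"
  by (auto simp: nonneg_def axis_def)

lemma dominated_at_nonzero:
  assumes g: "continuous_on UNIV g" and v: "tri t v v v > 0"
  shows "\<exists>C. \<forall>\<^sub>F w in nhds v. nonneg w \<longrightarrow> g w \<le> C * tri t w w w"
proof -
  let ?d = "tri t v v v / 2"
  let ?K = "\<bar>g v\<bar> + 1"
  have "continuous_on UNIV (\<lambda>w. - tri t w w w)"
    by (intro continuous_intros continuous_tri)
  from eventually_less_of_continuous[OF this, of v "- ?d"] eventually_less_of_continuous[OF g, of v ?K] v
  have "\<forall>\<^sub>F w in nhds v. tri t w w w > ?d" "\<forall>\<^sub>F w in nhds v. g w < ?K" by auto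
  then have "\<forall>\<^sub>F w in nhds v. nonneg w \<longrightarrow> g w \<le> ?K / ?d * tri t w w w"
  proof eventually_elim
    case (elim w)
    have "?K = ?K / ?d * ?d" using v by simp
    also have "\<dots> \<le> ?K / ?d * tri t w w w" using elim v by (intro mult_left_mono) auto
    finally show ?case using elim by linarith
  qed
  then show ?thesis by blast
qed

lemma dominated_at_nonsingular:
  assumes g: "\<And>w. g w = w $ l * h w" and h: "continuous_on UNIV h"
    and v: "v $ l = 0" "tri t v v (axis l 1) > 0"
  shows "\<exists>C. \<forall>\<^sub>F w in nhds v. nonneg w \<longrightarrow> g w \<le> C * tri t w w w"
proof -
  obtain c where c: "c > 0" "\<forall>\<^sub>F w in nhds v. nonneg w \<longrightarrow>
    tri t w w w \<ge> tri t (w - w $ l *s axis l 1) (w - w $ l *s axis l 1) (w - w $ l *s axis l 1) + c * w $ l"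
    using linear_growth[OF v] by blast
  let ?K = "\<bar>h v\<bar> + 1"
  have "\<forall>\<^sub>F w in nhds v. h w < ?K" by (rule eventually_less_of_continuous[OF h]) simp
  with c(2) have "\<forall>\<^sub>F w in nhds v. nonneg w \<longrightarrow> g w \<le> ?K / c * tri t w w w"
  proof eventually_elim
    case (elim w)
    show ?case
    proof
      assume w: "nonneg w"
      then have "c * w $ l \<le> tri t w w w" using elim(1) cop[OF nonneg_drop[OF w, of l]] by simp
      then have "?K / c * (c * w $ l) \<le> ?K / c * tri t w w w" using c by (intro mult_left_mono) simp_all
      moreover have "w $ l * h w \<le> w $ l * ?K"
        using w elim by (intro mult_left_mono) (auto simp: nonneg_def)
      ultimately show "g w \<le> ?K / c * tri t w w w" using c by (simp add: g mult.commute)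
    qed
  qed
  then show ?thesis by blast
qed

end


section \<open>Singular zeros of an extremal cubic\<close>

text \<open>A cubic in one variable that is nonnegative on the half-line has at most one double zero
  there, because the third zero is not positive.\<close>

lemma double_zero_unique:
  fixes a r r' b b' :: real
  assumes "a > 0" "r \<ge> 0" "r' \<ge> 0" "b \<ge> 0" "b' \<ge> 0"
    and eq: "\<And>y. (y - r)\<^sup>2 * (a * y + b) = (y - r')\<^sup>2 * (a * y + b')"
  shows "r = r'"
proof (rule ccontr)
  assume ne: "r \<noteq> r'"
  have "a * r + b' = 0" "a * r' + b = 0" using eq[of r] eq[of r'] ne by auto
  then have "a * r = 0" "a * r' = 0"
    using assms by (smt (verit) mult_nonneg_nonneg)+
  with ne assms(1) show False by simp
qed

lemma double_zero_factor:
  fixes a b c d r :: real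
  assumes nn: "\<And>y. y \<ge> 0 \<Longrightarrow> a * y ^ 3 + b * y\<^sup>2 + c * y + d \<ge> 0" and a: "a > 0" and r: "r \<ge> 0"
    and z: "a * r ^ 3 + b * r\<^sup>2 + c * r + d = 0" "3 * a * r\<^sup>2 + 2 * b * r + c = 0"
  obtains b' where "b' \<ge> 0"
    "\<And>y z. a * y ^ 3 + b * y\<^sup>2 * z + c * y * z\<^sup>2 + d * z ^ 3 = (y - r * z)\<^sup>2 * (a * y + b' * z)"
proof (rule that)
  let ?b = "b + 2 * a * r"
  have c: "c = - (3 * a * r\<^sup>2 + 2 * b * r)" using z by simp
  have d: "d = - (a * r ^ 3 + b * r\<^sup>2 + c * r)" using z by simp
  show factor: "a * y ^ 3 + b * y\<^sup>2 * z + c * y * z\<^sup>2 + d * z ^ 3 = (y - r * z)\<^sup>2 * (a * y + ?b * z)" for y z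
    by (simp add: d c power2_eq_square power3_eq_cube algebra_simps)
  show "?b \<ge> 0"
  proof (rule ccontr)
    assume neg: "\<not> ?b \<ge> 0"
    define y where "y = (if r = 0 then - ?b / (2 * a) else 0)"
    have "y \<ge> 0" "y \<noteq> r" "a * y + ?b < 0" using neg a r
      by (auto simp: y_def field_simps)
    then have "(y - r)\<^sup>2 * (a * y + ?b) < 0" by (intro mult_pos_neg) auto
    with nn[OF \<open>y \<ge> 0\<close>] factor[of y 1] show False by simp
  qed
qed

lemma nonneg_axis_combination:
  assumes "i \<noteq> j" "j \<noteq> k" "i \<noteq> k"
  shows "nonneg v \<longleftrightarrow> v $ i \<ge> 0 \<and> v $ j \<ge> 0 \<and> v $ k \<ge> 0"
  unfolding nonneg_def
proof (intro iffI conjI allI)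
  show "v $ l \<ge> 0" if "0 \<le> v $ i \<and> 0 \<le> v $ j \<and> 0 \<le> v $ k" for l
    using three_indices[OF assms, of l] that by auto
qed auto

locale extremal_cubic =
  fixes f :: "(3, real) mpoly" and t :: "3 \<Rightarrow> 3 \<Rightarrow> 3 \<Rightarrow> real"
  assumes ext: "f \<in> extremal P33_plus" and irr: "irreducible f" and sym_t: "sym3 t"
    and eval: "\<And>v. poly_eval (complexify f) v = ctri t v v v"
begin

lemma hom: "homogeneous 3 f"
  using ext by (simp add: extremal_def P33_plus_def)

lemma real_eval: "poly_eval f v = tri t v v v"
  by (rule poly_eval_tri[OF eval])

sublocale copositive_cubic t
proof
  show "sym3 t" by (rule sym_t)
  have "f \<in> P33_plus" using ext by (simp add: extremal_def)
  then have "\<forall>v. (\<forall>i. v $ i \<ge> 0) \<longrightarrow> poly_eval f v \<ge> 0" by (simp add: P33_plus_def)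
  then show "tri t v v v \<ge> 0" if "nonneg v" for v
    using that by (simp add: nonneg_def real_eval)
qed

lemma singular_cubicI:
  assumes "i \<noteq> j" "j \<noteq> k" "i \<noteq> k" "P $ j = 1" "\<And>w. tri t P P w = 0"
  shows "singular_cubic f t P i j k"
  by unfold_locales (fact assms hom irr sym_t eval)+

lemma no_locally_dominated_product:
  assumes "homogeneous 3 (a * b)" "poly_eval a 0 = 0" "poly_eval b 0 = 0"
    and "poly_eval (a * b) u \<noteq> 0"
    and "\<And>v. nonneg v \<Longrightarrow> poly_eval (a * b) v \<ge> 0"
    and "\<And>v. nonneg v \<Longrightarrow> v \<noteq> 0 \<Longrightarrow>
      \<exists>C. \<forall>\<^sub>F w in nhds v. nonneg w \<longrightarrow> poly_eval (a * b) w \<le> C * tri t w w w"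
  shows False
proof -
  have "\<exists>C. \<forall>w. nonneg w \<longrightarrow> poly_eval (a * b) w \<le> C * tri t w w w"
  proof (rule local_to_global)
    show "tri t (c *s v) (c *s v) (c *s v) = c ^ 3 * tri t v v v" for c v
      by (simp add: tri_scale power3_eq_cube)
    show "poly_eval (a * b) (c *s v) = c ^ 3 * poly_eval (a * b) v" for c v
      by (rule poly_eval_homogeneous[OF assms(1)])
  qed (fact cop assms(6))+
  then obtain C where "\<And>w. nonneg w \<Longrightarrow> poly_eval (a * b) w \<le> C * poly_eval f w"
    unfolding real_eval by blast
  from extremal_no_minorant[OF ext irr assms(1-5) this] show False .
qed

text \<open>If every zero in the triangle is smooth, then near each of them the cubic grows at least
  linearly in a coordinate that vanishes there, hence dominates \<open>x y z\<close>.\<close>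

lemma singular_zero_exists:
  "\<exists>p. nonneg p \<and> p \<noteq> 0 \<and> (\<forall>w. tri t p p w = 0)"
proof (rule ccontr)
  assume "\<not> ?thesis"
  then have no: "\<And>p. nonneg p \<Longrightarrow> p \<noteq> 0 \<Longrightarrow> \<exists>w. tri t p p w \<noteq> 0" by blast
  let ?a = "poly_var 1 :: (3, real) mpoly" and ?b = "poly_var 2 * poly_var 3 :: (3, real) mpoly"
  have g: "poly_eval (?a * ?b) w = (\<Prod>m\<in>UNIV. w $ m)" for w
    by (simp only: UNIV_3) simp
  show False
  proof (rule no_locally_dominated_product[of ?a ?b "vec 1"])
    show "homogeneous 3 (?a * ?b)"
      by (rule homogeneous_mult[OF homogeneous_var homogeneous_mult[OF homogeneous_var homogeneous_var refl]]) simp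
    show "poly_eval (?a * ?b) v \<ge> 0" if "nonneg v" for v
      using that by (simp add: nonneg_def)
    fix v assume v: "nonneg v" "v \<noteq> 0"
    show "\<exists>C. \<forall>\<^sub>F w in nhds v. nonneg w \<longrightarrow> poly_eval (?a * ?b) w \<le> C * tri t w w w"
    proof (cases "tri t v v v = 0")
      case False
      with cop[OF v(1)] have "tri t v v v > 0" by simp
      then show ?thesis unfolding g
        by (intro dominated_at_nonzero continuous_intros)
    next
      case True
      obtain u where "tri t v v u \<noteq> 0" using no[OF v] by blast
      from nonsingular_zero[OF v(1) True this] obtain l where l: "v $ l = 0" "tri t v v (axis l 1) > 0"
        by blast
      show ?thesis unfolding g
      proof (rule dominated_at_nonsingular[OF _ _ l])
        show "(\<Prod>m\<in>UNIV. w $ m) = w $ l * (\<Prod>m\<in>UNIV - {l}. w $ m)" for w :: "real ^ 3"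
          by (rule prod.remove) auto
        show "continuous_on UNIV (\<lambda>w :: real ^ 3. \<Prod>m\<in>UNIV - {l}. w $ m)"
          by (intro continuous_intros)
      qed
    qed
  qed (simp_all)
qed

text \<open>A cubic singular at the vertex \<open>e\<^sub>j\<close> is \<open>x\<^sub>j q + k\<close> with forms \<open>q\<close>, \<open>k\<close> in the other two
  variables, and both summands are copositive.\<close>

lemma vertex_not_singular:
  assumes ijk: "i \<noteq> j" "j \<noteq> k" "i \<noteq> k" and sing: "\<And>w. tri t (axis j 1) (axis j 1) w = 0"
  shows False
proof -
  interpret S: singular_cubic f t "axis j 1" i j k
    using ijk sing by (intro singular_cubicI) auto
  have f: "tri t v v v = v $ j * S.qf (v $ k) (v $ i) + S.kf (v $ k) (v $ i)" for v
  proof -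
    have ax: "(axis j 1 :: real ^ 3) $ j = 1" "(axis j 1 :: real ^ 3) $ k = 0" "(axis j 1 :: real ^ 3) $ i = 0"
      using ijk by (simp_all add: axis_def)
    have v: "v = v $ j *s axis j 1 + v $ k *s axis k 1 + v $ i *s axis i 1"
      using S.coordinates[OF ax(1), of v] unfolding ax mult_zero_left diff_zero .
    have "poly_eval f v = poly_eval f (v $ j *s axis j 1 + v $ k *s axis k 1 + v $ i *s axis i 1)"
      by (rule arg_cong[OF v])
    then show ?thesis unfolding real_eval[symmetric] S.real_eval_qf_kf .
  qed
  have nn: "y * S.qf s z + S.kf s z \<ge> 0" if "y \<ge> 0" "s \<ge> 0" "z \<ge> 0" for y s z :: real
  proof -
    have "nonneg (\<chi> l. if l = j then y else if l = k then s else z)"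
      using that by (auto simp: nonneg_def)
    from cop[OF this] show ?thesis using ijk by (simp add: f)
  qed
  have k: "S.kf s z \<ge> 0" if "s \<ge> 0" "z \<ge> 0" for s z :: real
    using nn[of 0 s z] that by simp
  have q: "S.qf s z \<ge> 0" if sz: "s \<ge> 0" "z \<ge> 0" for s z :: real
  proof (rule ccontr)
    assume neg: "\<not> ?thesis"
    define y where "y = (S.kf s z + 1) / (- S.qf s z)"
    have "y \<ge> 0" unfolding y_def using neg k[OF sz] by (intro divide_nonneg_pos) auto
    moreover have "y * S.qf s z = - (S.kf s z + 1)" using neg by (simp add: y_def)
    ultimately show False using nn[of y s z] sz by simp
  qed
  define a :: "(3, real) mpoly" where "a = poly_var j"
  define b :: "(3, real) mpoly" where
    "b = poly_const (3 * tri t (axis j 1) (axis k 1) (axis k 1)) * (poly_var k * poly_var k)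
      + poly_const (6 * tri t (axis j 1) (axis k 1) (axis i 1)) * (poly_var k * poly_var i)
      + poly_const (3 * tri t (axis j 1) (axis i 1) (axis i 1)) * (poly_var i * poly_var i)"
  have ab: "poly_eval (a * b) v = v $ j * S.qf (v $ k) (v $ i)" for v
    by (simp add: a_def b_def S.qf_def power2_eq_square mult.assoc)
  obtain s z :: real where sz: "s \<noteq> 0 \<or> z \<noteq> 0" "S.kf s z = 0"
    using real_cubic_zero unfolding S.kf_def of_real_eq_id id_apply by blast
  with S.no_real_common_zero have q0: "S.qf s z \<noteq> 0" by blast
  show False
  proof (rule extremal_no_minorant[OF ext irr])
    have "homogeneous 2 b" unfolding b_def
      by (intro homogeneous_add homogeneous_const_mult homogeneous_mult[OF homogeneous_var homogeneous_var]) simp_all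
    then show "homogeneous 3 (a * b)" unfolding a_def
      by (intro homogeneous_mult[OF homogeneous_var]) simp_all
    show "poly_eval a 0 = 0" "poly_eval b 0 = 0" by (simp_all add: a_def b_def)
    show "poly_eval (a * b) (\<chi> l. if l = j then 1 else if l = k then s else z) \<noteq> 0"
      unfolding ab using q0 ijk by simp
    show "poly_eval (a * b) v \<ge> 0" if "nonneg v" for v
      unfolding ab using that q by (simp add: nonneg_def)
    show "poly_eval (a * b) v \<le> 1 * poly_eval f v" if "nonneg v" for v
      unfolding ab real_eval f using that k by (simp add: nonneg_def)
  qed
qed

text \<open>Let \<open>P\<close> be an acnode on the edge \<open>x\<^sub>i = 0\<close>, and \<open>f(e\<^sub>j) > 0\<close>.  Apart from \<open>P\<close>, a zero can only
  be critical for \<open>x\<^sub>j m\<^sup>2\<close> if it lies on the edge \<open>x\<^sub>k = 0\<close> and \<open>f\<close> restricted to that edge has a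
  double zero there.  There is at most one such zero \<open>r e\<^sub>j + e\<^sub>i\<close>; let \<open>m = 0\<close> be the line joining
  it to \<open>P\<close>.  Then \<open>x\<^sub>j m\<^sup>2\<close> is dominated by \<open>f\<close> near \<open>P\<close>, where it vanishes to second order, and
  near the other zero because \<open>f\<close> restricted to the edge is at least a multiple of it.\<close>

lemma no_acnode_on_edge_if_vertex_positive:
  assumes ijk: "i \<noteq> j" "j \<noteq> k" "i \<noteq> k"
    and P: "P $ i = 0" "P $ j = 1" "P $ k > 0"
    and sing: "\<And>w. tri t P P w = 0"
    and definite: "\<And>s z. s \<noteq> 0 \<or> z \<noteq> 0 \<Longrightarrow>
      tri t P (s *s axis k 1 + z *s axis i 1) (s *s axis k 1 + z *s axis i 1) > 0"
    and fj: "tri t (axis j 1) (axis j 1) (axis j 1) > 0"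
  shows False
proof -
  interpret S: singular_cubic f t P i j k
    using ijk P sing by (intro singular_cubicI) auto
  define p where "p = P $ k"
  have p: "p > 0" using P by (simp add: p_def)
  let ?ei = "axis i 1 :: real ^ 3" and ?ej = "axis j 1 :: real ^ 3" and ?ek = "axis k 1 :: real ^ 3"
  have coord: "v = v $ j *s P + (v $ k - p * v $ j) *s ?ek + v $ i *s ?ei" for v
    using S.coordinates[OF P(2), of v, unfolded P(1) mult_zero_left diff_zero] unfolding p_def .
  have f: "tri t v v v = v $ j * S.qf (v $ k - p * v $ j) (v $ i) + S.kf (v $ k - p * v $ j) (v $ i)" for v
    using arg_cong[OF coord[of v], of "poly_eval f"] unfolding S.real_eval_qf_kf unfolding real_eval .
  have qpos: "S.qf s z > 0" if "s \<noteq> 0 \<or> z \<noteq> 0" for s z :: real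
    using definite[OF that] by (simp add: S.qf_tri)
  have nonsing: "\<exists>u. tri t v v u \<noteq> 0" if "v $ k - p * v $ j \<noteq> 0 \<or> v $ i \<noteq> 0" for v
  proof -
    have "tri t v v P = tri t P v v" by (simp add: tri_ac[OF sym_t])
    also have "\<dots> = tri t P ((v $ k - p * v $ j) *s ?ek + v $ i *s ?ei) ((v $ k - p * v $ j) *s ?ek + v $ i *s ?ei)"
      using arg_cong[OF coord[of v], of "\<lambda>v. tri t P v v"]
        tri_polar[OF sym_t, of P "v $ j" "v $ k - p * v $ j" ?ek "v $ i" ?ei]
        tri_polar[OF sym_t, of P 0 "v $ k - p * v $ j" ?ek "v $ i" ?ei]
      by (simp add: sing)
    finally have "tri t v v P > 0" using definite[OF that] by simp
    then show ?thesis by (intro exI[of _ P]) simp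
  qed
  note nonneg = nonneg_axis_combination[OF ijk]
  \<comment> \<open>On the edge through \<open>P\<close> the zero \<open>P\<close> is double, and the only other possible zero is \<open>e\<^sub>k\<close>, where the
    derivative in the direction \<open>e\<^sub>j\<close> is positive.\<close>
  define A D where "A = 3 * tri t P ?ek ?ek" and "D = tri t ?ek ?ek ?ek"
  have edge_i: "tri t v v v = (v $ k - p * v $ j)\<^sup>2 * (D * v $ k + (A - p * D) * v $ j)" if "v $ i = 0" for v
    unfolding f that by (simp add: S.qf_def S.kf_def A_def D_def power2_eq_square power3_eq_cube algebra_simps)
  have A: "A > 0" using definite[of 1 0] by (simp add: A_def)
  have D: "D \<ge> 0" unfolding D_def by (intro cop) (simp add: nonneg_def axis_def)
  have "p\<^sup>2 * (A - p * D) > 0" using fj edge_i[of ?ej] ijk by (simp add: axis_def)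
  then have AD: "A - p * D > 0" by (simp add: zero_less_mult_iff)
  have critical: "v $ j = 0 \<and> tri t v v ?ej > 0"
    if v: "nonneg v" "v \<noteq> 0" "tri t v v v = 0" "v $ i = 0" "v $ k \<noteq> p * v $ j" for v
  proof -
    have "D * v $ k + (A - p * D) * v $ j = 0" using edge_i[OF v(4)] v by simp
    moreover have "D * v $ k \<ge> 0" "(A - p * D) * v $ j \<ge> 0" using v(1) D AD by (simp_all add: nonneg)
    ultimately have Dk: "D * v $ k = 0" and "(A - p * D) * v $ j = 0" by linarith+
    then have vj: "v $ j = 0" using AD by (simp only: mult_eq_0_iff) auto
    have "v $ k \<noteq> 0" using v vj by simp
    with Dk have D0: "D = 0" by simp
    note coord[of v]
    also have "v $ j *s P + (v $ k - p * v $ j) *s ?ek + v $ i *s ?ei = v $ k *s ?ek"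
      using vj v(4) by simp
    finally have vk: "v = v $ k *s ?ek" .
    have ax: "?ej $ j = 1" "?ej $ k = 0" "?ej $ i = 0" using ijk by (simp_all add: axis_def)
    have ej: "?ej = 1 *s P + (- p) *s ?ek" using coord[of ?ej] unfolding ax by simp
    have "tri t v v ?ej = (v $ k)\<^sup>2 * tri t ?ek ?ek ?ej"
      using arg_cong[OF vk, of "\<lambda>v. tri t v v ?ej"] by (simp add: tri_scale power2_eq_square)
    also have "tri t ?ek ?ek ?ej = tri t P ?ek ?ek - p * D"
      using tri_swap'[OF sym_t, of ?ek ?ek P]
      by (subst ej) (simp only: tri_add tri_scale D_def; simp)
    finally show ?thesis using vj D0 A \<open>v $ k \<noteq> 0\<close> by (simp add: A_def)
  qed
  \<comment> \<open>On the edge \<open>x\<^sub>k = 0\<close> the critical zeros (predicate \<open>R\<close>) are double zeros of a binary cubic.\<close>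
  define c3 c2 c1 c0 where "c3 = tri t ?ej ?ej ?ej" and "c2 = 3 * tri t ?ej ?ej ?ei"
    and "c1 = 3 * tri t ?ej ?ei ?ei" and "c0 = tri t ?ei ?ei ?ei"
  have edge_k: "tri t (y *s ?ej + z *s ?ei) (y *s ?ej + z *s ?ei) (y *s ?ej + z *s ?ei)
      = c3 * y ^ 3 + c2 * y\<^sup>2 * z + c1 * y * z\<^sup>2 + c0 * z ^ 3" for y z
    using tri_expand[OF sym_t, of 0 0 y ?ej z ?ei] by (simp add: c3_def c2_def c1_def c0_def)
  have c3: "c3 > 0" using fj by (simp add: c3_def)
  have drop_k: "v - v $ k *s ?ek = v $ j *s ?ej + v $ i *s ?ei" for v
    unfolding vec_eq_iff
  proof
    show "(v - v $ k *s ?ek) $ x = (v $ j *s ?ej + v $ i *s ?ei) $ x" for x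
      using S.three[of x] ijk by (auto simp: axis_def)
  qed
  have edge_nonneg: "c3 * y ^ 3 + c2 * y\<^sup>2 + c1 * y + c0 \<ge> 0" if "y \<ge> 0" for y
  proof -
    have "nonneg (y *s ?ej + 1 *s ?ei)" using that by (auto simp: nonneg_def axis_def)
    from cop[OF this] show ?thesis unfolding edge_k by simp
  qed
  define R where "R v \<longleftrightarrow> nonneg v \<and> v $ k = 0 \<and> v $ i > 0 \<and> tri t v v v = 0 \<and> tri t v v ?ej = 0" for v
  have factor: "\<exists>b\<ge>0. \<forall>y z. c3 * y ^ 3 + c2 * y\<^sup>2 * z + c1 * y * z\<^sup>2 + c0 * z ^ 3
      = (y - v $ j / v $ i * z)\<^sup>2 * (c3 * y + b * z)" if R: "R v" for v
  proof -
    let ?r = "v $ j / v $ i"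
    have vi: "v $ i > 0" "v $ k = 0" "v $ j \<ge> 0" using R by (auto simp: R_def nonneg)
    have "v = v - v $ k *s ?ek" using vi(2) by simp
    also note drop_k
    finally have v: "v = v $ j *s ?ej + v $ i *s ?ei" .
    have "c3 * (v $ j) ^ 3 + c2 * (v $ j)\<^sup>2 * v $ i + c1 * v $ j * (v $ i)\<^sup>2 + c0 * (v $ i) ^ 3 = 0"
      using R arg_cong[OF v, of "\<lambda>v. tri t v v v"] unfolding edge_k by (simp add: R_def)
    moreover have "c3 * ?r ^ 3 + c2 * ?r\<^sup>2 + c1 * ?r + c0
        = (c3 * (v $ j) ^ 3 + c2 * (v $ j)\<^sup>2 * v $ i + c1 * v $ j * (v $ i)\<^sup>2 + c0 * (v $ i) ^ 3) / (v $ i) ^ 3"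
      using vi by (simp add: power2_eq_square power3_eq_cube field_simps)
    ultimately have z0: "c3 * ?r ^ 3 + c2 * ?r\<^sup>2 + c1 * ?r + c0 = 0" by simp
    have "3 * tri t v v ?ej = 3 * c3 * (v $ j)\<^sup>2 + 2 * c2 * v $ j * v $ i + c1 * (v $ i)\<^sup>2"
    proof -
      have "tri t v v ?ej = tri t ?ej v v" by (simp add: tri_ac[OF sym_t])
      also have "\<dots> = c3 * (v $ j)\<^sup>2 + 2 * tri t ?ej ?ej ?ei * v $ j * v $ i + tri t ?ej ?ei ?ei * (v $ i)\<^sup>2"
        using arg_cong[OF v, of "\<lambda>v. tri t ?ej v v"] tri_polar[OF sym_t, of ?ej 0 "v $ j" ?ej "v $ i" ?ei]
        by (simp add: c3_def)
      finally show ?thesis by (simp add: c2_def c1_def)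
    qed
    moreover have "3 * c3 * ?r\<^sup>2 + 2 * c2 * ?r + c1
        = (3 * c3 * (v $ j)\<^sup>2 + 2 * c2 * v $ j * v $ i + c1 * (v $ i)\<^sup>2) / (v $ i)\<^sup>2"
      using vi by (simp add: power2_eq_square field_simps)
    ultimately have z1: "3 * c3 * ?r\<^sup>2 + 2 * c2 * ?r + c1 = 0" using R by (simp add: R_def)
    have "?r \<ge> 0" using vi by simp
    from double_zero_factor[OF edge_nonneg c3 this z0 z1] show ?thesis by metis
  qed
  obtain r where r: "\<And>v. R v \<Longrightarrow> v $ j / v $ i = r"
  proof (cases "\<exists>v. R v")
    case False
    then show ?thesis using that by blast
  next
    case True
    then obtain u where u: "R u" by blast
    show ?thesis
    proof (rule that)
      fix v assume v: "R v"
      from factor[OF u] factor[OF v] obtain b b' where b: "b \<ge> 0" "b' \<ge> 0"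
        and eq: "\<And>y z. (y - u $ j / u $ i * z)\<^sup>2 * (c3 * y + b * z) = (y - v $ j / v $ i * z)\<^sup>2 * (c3 * y + b' * z)"
        by metis
      have "u $ j / u $ i \<ge> 0" "v $ j / v $ i \<ge> 0" using u v by (auto simp: R_def nonneg)
      from double_zero_unique[OF c3 this b] eq[of _ 1] show "v $ j / v $ i = u $ j / u $ i" by simp
    qed
  qed
  \<comment> \<open>the line through \<open>P = p e\<^sub>k + e\<^sub>j\<close> and \<open>r e\<^sub>j + e\<^sub>i\<close>\<close>
  define m where "m w = w $ k - p * w $ j + p * r * w $ i" for w :: "real ^ 3"
  define a :: "(3, real) mpoly" where "a = poly_var j"
  define l :: "(3, real) mpoly" where
    "l = poly_var k - poly_const p * poly_var j + poly_const (p * r) * poly_var i"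
  have g: "poly_eval (a * (l * l)) w = w $ j * (m w)\<^sup>2" for w
    by (simp add: a_def l_def m_def power2_eq_square)
  have m_cont: "continuous_on UNIV m" unfolding m_def by (intro continuous_intros)
  show False
  proof (rule no_locally_dominated_product[of a "l * l" ?ej])
    have "homogeneous (Suc 0) l" unfolding l_def
      by (intro homogeneous_add homogeneous_diff homogeneous_const_mult) simp_all
    then have "homogeneous 2 (l * l)" by (intro homogeneous_mult[of "Suc 0"]) simp_all
    then show "homogeneous 3 (a * (l * l))" unfolding a_def
      by (intro homogeneous_mult[OF homogeneous_var]) simp_all
    show "poly_eval a 0 = 0" "poly_eval (l * l) 0 = 0" by (simp_all add: a_def l_def)
    show "poly_eval (a * (l * l)) ?ej \<noteq> 0" unfolding g using p ijk by (simp add: m_def axis_def)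
    show "poly_eval (a * (l * l)) v \<ge> 0" if "nonneg v" for v unfolding g using that by (simp add: nonneg)
    fix v assume v: "nonneg v" "v \<noteq> 0"
    show "\<exists>C. \<forall>\<^sub>F w in nhds v. nonneg w \<longrightarrow> poly_eval (a * (l * l)) w \<le> C * tri t w w w"
    proof (cases "tri t v v v = 0")
      case False
      with cop[OF v(1)] have "tri t v v v > 0" by simp
      then show ?thesis unfolding g
        by (intro dominated_at_nonzero continuous_intros m_cont)
    next
      case zero: True
      show ?thesis
      proof (cases "v $ k = p * v $ j \<and> v $ i = 0")
        case True
        have "v $ j \<noteq> 0"
        proof
          assume vj: "v $ j = 0"
          note coord[of v]
          also have "v $ j *s P + (v $ k - p * v $ j) *s ?ek + v $ i *s ?ei = 0"
            using vj True by simp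
          finally show False using v(2) by simp
        qed
        then have vj: "v $ j > 0" using v(1) by (auto simp: nonneg less_le)
        obtain \<epsilon> \<delta> where ed: "\<epsilon> > 0" "\<delta> > 0"
          "\<And>y s z :: real. y > 0 \<Longrightarrow> \<bar>s\<bar> + \<bar>z\<bar> \<le> \<epsilon> * y \<Longrightarrow> y * S.qf s z + S.kf s z \<ge> \<delta> * y * (s\<^sup>2 + z\<^sup>2)"
          using S.definite_lower_bound[OF qpos] by blast
        define M where "M = 1 + (p * r)\<^sup>2"
        have "\<forall>\<^sub>F w in nhds v. \<bar>w $ k - p * w $ j\<bar> + \<bar>w $ i\<bar> - \<epsilon> * w $ j < 0"
          by (rule eventually_less_of_continuous)
            (use True vj ed in \<open>auto intro!: continuous_intros\<close>)
        moreover have "\<forall>\<^sub>F w in nhds v. - w $ j < 0"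
          by (rule eventually_less_of_continuous) (use vj in \<open>auto intro!: continuous_intros\<close>)
        ultimately have "\<forall>\<^sub>F w in nhds v. nonneg w \<longrightarrow> w $ j * (m w)\<^sup>2 \<le> M / \<delta> * tri t w w w"
        proof eventually_elim
          case (elim w)
          define s z where "s = w $ k - p * w $ j" and "z = w $ i"
          have "M * (s\<^sup>2 + z\<^sup>2) - (m w)\<^sup>2 = (p * r * s - z)\<^sup>2"
            by (simp add: M_def m_def s_def z_def power2_eq_square algebra_simps)
          then have "(m w)\<^sup>2 \<le> M * (s\<^sup>2 + z\<^sup>2)" using zero_le_power2[of "p * r * s - z"] by linarith
          then have "w $ j * (m w)\<^sup>2 \<le> w $ j * (M * (s\<^sup>2 + z\<^sup>2))" using elim by (intro mult_left_mono) simp_all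
          also have "\<dots> = M / \<delta> * (\<delta> * w $ j * (s\<^sup>2 + z\<^sup>2))" using ed by simp
          also have "\<dots> \<le> M / \<delta> * tri t w w w"
            using ed(3)[of "w $ j" s z] elim ed(2) unfolding f[of w] s_def[symmetric] z_def[symmetric]
            by (intro mult_left_mono) (auto simp: M_def)
          finally show ?case by blast
        qed
        then show ?thesis unfolding g by blast
      next
        case False
        then have "v $ k - p * v $ j \<noteq> 0 \<or> v $ i \<noteq> 0" by auto
        from nonsing[OF this] obtain u where "tri t v v u \<noteq> 0" by blast
        from nonsingular_zero[OF v(1) zero this] obtain n where n: "v $ n = 0" "tri t v v (axis n 1) > 0"
          by blast
        show ?thesis
        proof (cases "v $ j = 0 \<and> tri t v v ?ej > 0")
          case True
          show ?thesis unfolding g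
            by (rule dominated_at_nonsingular[of _ j "\<lambda>w. (m w)\<^sup>2"])
              (use True in \<open>auto intro!: continuous_intros m_cont\<close>)
        next
          case nj: False
          have "v $ i \<noteq> 0" using critical[OF v zero] nj False by blast
          then have vi: "v $ i > 0" using v(1) by (auto simp: nonneg less_le)
          then have "n = k" using S.three[of n] n nj by auto
          with n have vk: "v $ k = 0" "tri t v v ?ek > 0" by simp_all
          have "tri t v v ?ej = 0"
            using gradient_nonneg[OF v(1) zero, of j] nj v(1) by (auto simp: nonneg less_le)
          then have "R v" using v vi vk zero by (simp add: R_def)
          from factor[OF this] obtain b where b: "b \<ge> 0" and
            fac: "\<And>y z. c3 * y ^ 3 + c2 * y\<^sup>2 * z + c1 * y * z\<^sup>2 + c0 * z ^ 3 = (y - r * z)\<^sup>2 * (c3 * y + b * z)"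
            unfolding r[OF \<open>R v\<close>] by blast
          from linear_growth[OF vk] obtain c where c: "c > 0" "\<forall>\<^sub>F w in nhds v. nonneg w \<longrightarrow>
            tri t w w w \<ge> tri t (w - w $ k *s ?ek) (w - w $ k *s ?ek) (w - w $ k *s ?ek) + c * w $ k" by blast
          \<comment> \<open>\<open>w\<^sub>k h(w)\<close> is the part of \<open>w\<^sub>j m(w)\<^sup>2\<close> that is divisible by \<open>w\<^sub>k\<close>.\<close>
          define h where "h w = w $ j * (w $ k - 2 * p * (w $ j - r * w $ i))" for w :: "real ^ 3"
          define K where "K = \<bar>h v\<bar> + 1"
          have "continuous_on UNIV h" unfolding h_def by (intro continuous_intros)
          then have "\<forall>\<^sub>F w in nhds v. h w < K" by (rule eventually_less_of_continuous) (simp add: K_def)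
          with c(2) have "\<forall>\<^sub>F w in nhds v. nonneg w \<longrightarrow> w $ j * (m w)\<^sup>2 \<le> (p\<^sup>2 / c3 + K / c) * tri t w w w"
          proof eventually_elim
            case (elim w)
            show ?case
            proof
              assume w: "nonneg w"
              define E where "E = (w $ j - r * w $ i)\<^sup>2 * (c3 * w $ j + b * w $ i)"
              have wnn: "w $ i \<ge> 0" "w $ j \<ge> 0" "w $ k \<ge> 0" using w by (simp_all add: nonneg)
              have fE: "tri t w w w \<ge> E + c * w $ k"
                using elim(1) w unfolding drop_k edge_k fac E_def by blast
              have "E = c3 * ((w $ j - r * w $ i)\<^sup>2 * w $ j) + (w $ j - r * w $ i)\<^sup>2 * (b * w $ i)"
                by (simp add: E_def algebra_simps)
              moreover have "(w $ j - r * w $ i)\<^sup>2 * (b * w $ i) \<ge> 0" using b wnn by simp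
              ultimately have E: "c3 * ((w $ j - r * w $ i)\<^sup>2 * w $ j) \<le> E" by linarith
              have "E \<ge> 0" unfolding E_def using b c3 wnn by simp
              moreover have "c * w $ k \<ge> 0" using c(1) wnn by simp
              ultimately have bounds: "E \<le> tri t w w w" "c * w $ k \<le> tri t w w w"
                using fE by linarith+
              have "w $ j * (m w)\<^sup>2 = p\<^sup>2 / c3 * (c3 * ((w $ j - r * w $ i)\<^sup>2 * w $ j)) + w $ k * h w"
                using c3 by (simp add: m_def h_def power2_eq_square algebra_simps)
              also have "\<dots> \<le> p\<^sup>2 / c3 * E + w $ k * K"
                using E c3 wnn elim(2) by (intro add_mono mult_left_mono) auto
              also have "w $ k * K = K / c * (c * w $ k)" using c by simp
              also have "p\<^sup>2 / c3 * E + K / c * (c * w $ k) \<le> p\<^sup>2 / c3 * tri t w w w + K / c * tri t w w w"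
                using bounds c(1) c3 by (intro add_mono mult_left_mono) (auto simp: K_def)
              finally show "w $ j * (m w)\<^sup>2 \<le> (p\<^sup>2 / c3 + K / c) * tri t w w w"
                by (simp only: distrib_right)
            qed
          qed
          then show ?thesis unfolding g by blast
        qed
      qed
    qed
  qed
qed

text \<open>Expanding \<open>f(P - p e\<^sub>k) = f(e\<^sub>j)\<close> shows that \<open>f(e\<^sub>j) + p\<^sup>3 f(e\<^sub>k)\<close> is a positive multiple of the
  quadratic part in the direction of the edge, so one of the two vertices is not a zero, and both play
  the same role.\<close>

lemma no_acnode_on_edge:
  assumes ijk: "i \<noteq> j" "j \<noteq> k" "i \<noteq> k"
    and P: "P $ i = 0" "P $ j = 1" "P $ k > 0"
    and sing: "\<And>w. tri t P P w = 0"
    and definite: "\<And>s z. s \<noteq> 0 \<or> z \<noteq> 0 \<Longrightarrow>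
      tri t P (s *s axis k 1 + z *s axis i 1) (s *s axis k 1 + z *s axis i 1) > 0"
  shows False
proof -
  define p where "p = P $ k"
  have p: "p > 0" using P by (simp add: p_def)
  let ?ei = "axis i 1 :: real ^ 3" and ?ej = "axis j 1 :: real ^ 3" and ?ek = "axis k 1 :: real ^ 3"
  have ej: "s *s ?ej + z *s ?ei = s *s P + (- p * s) *s ?ek + z *s ?ei" for s z
    unfolding vec_eq_iff
  proof
    show "(s *s ?ej + z *s ?ei) $ x = (s *s P + (- p * s) *s ?ek + z *s ?ei) $ x" for x
      using three_indices[OF ijk, of x] ijk P by (auto simp: axis_def p_def)
  qed
  have "tri t ?ej ?ej ?ej + p ^ 3 * tri t ?ek ?ek ?ek = 3 * p\<^sup>2 * tri t P ?ek ?ek"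
    using tri_expand[OF sym_t, of 1 P "- p" ?ek 0 ?ei] ej[of 1 0]
    by (simp add: sing)
  also have "\<dots> > 0" using definite[of 1 0] p by simp
  finally have "tri t ?ej ?ej ?ej \<noteq> 0 \<or> tri t ?ek ?ek ?ek \<noteq> 0" by auto
  moreover have "tri t ?ej ?ej ?ej \<ge> 0" "tri t ?ek ?ek ?ek \<ge> 0"
    by (intro cop; simp add: nonneg_def axis_def)+
  ultimately consider "tri t ?ej ?ej ?ej > 0" | "tri t ?ek ?ek ?ek > 0" by linarith
  then show False
  proof cases
    case 1
    show False by (rule no_acnode_on_edge_if_vertex_positive[OF ijk P sing definite 1])
  next
    case 2
    define Q where "Q = (1 / p) *s P"
    have "tri t Q (s *s ?ej + z *s ?ei) (s *s ?ej + z *s ?ei) > 0" if "s \<noteq> 0 \<or> z \<noteq> 0" for s z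
    proof -
      have "- p * s \<noteq> 0 \<or> z \<noteq> 0" using that p by simp
      from definite[OF this] have "tri t P (s *s ?ej + z *s ?ei) (s *s ?ej + z *s ?ei) > 0"
        unfolding ej tri_polar[OF sym_t]
        using tri_polar[OF sym_t, of P 0 "- p * s" ?ek z ?ei] by (simp add: sing)
      then show ?thesis using p by (simp add: Q_def tri_scale)
    qed
    moreover have "tri t Q Q w = 0" for w by (simp add: Q_def tri_scale sing)
    moreover have "Q $ i = 0" "Q $ k = 1" "Q $ j > 0" using P p by (simp_all add: Q_def p_def)
    ultimately show False using no_acnode_on_edge_if_vertex_positive[of i k j Q] ijk 2 by blast
  qed
qed

text \<open>Both \<open>w\<close> and \<open>- w\<close> are feasible at an interior point, so a null direction of \<open>q\<close> is also a zero of
  \<open>k\<close>.\<close>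

lemma interior_case:
  assumes ijk: "i \<noteq> j" "j \<noteq> k" "i \<noteq> k"
    and P: "P $ j = 1" "\<And>l. P $ l > 0" and sing: "\<And>w. tri t P P w = 0"
  shows "rational_curve (V_complex f) \<and> singular_points (complexify f) = {complex_point (abs_proj P)}
    \<and> acnode f (abs_proj P)"
proof -
  interpret S: singular_cubic f t P i j k
    using ijk P sing by (intro singular_cubicI) auto
  have feasible: "feasible P w" for w using P(2) by (simp add: feasible_def)
  have pos: "S.qf s z > 0" if "s \<noteq> 0 \<or> z \<noteq> 0" for s z :: real
  proof (rule ccontr)
    let ?w = "s *s axis k 1 + z *s axis i 1 :: real ^ 3"
    assume "\<not> ?thesis"
    moreover have "tri t P ?w ?w \<ge> 0" by (rule second_order[OF feasible]) (simp_all add: sing)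
    ultimately have "tri t P ?w ?w = 0" by (simp add: S.qf_tri)
    moreover from third_order_zero[OF feasible feasible sing sing this] have "S.kf s z = 0"
      unfolding S.kf_tri .
    ultimately show False using S.no_real_common_zero[of s z] that by (simp add: S.qf_tri)
  qed
  from pos[of 1 0] have "tri t P (axis k 1) (axis k 1) \<noteq> 0" by (auto simp: S.qf_def)
  then show ?thesis
    using S.rational_curve_V S.singular_point_unique S.acnode_P[OF pos] by blast
qed

text \<open>Only the directions into the triangle are feasible, but \<open>q\<close> is even, so it is still semidefinite;
  the direction of the edge is feasible both ways and is treated as at an interior point.\<close>

lemma edge_case:
  assumes ijk: "i \<noteq> j" "j \<noteq> k" "i \<noteq> k"
    and P: "P $ i = 0" "P $ j = 1" "P $ k > 0" and sing: "\<And>w. tri t P P w = 0"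
  shows "rational_curve (V_complex f) \<and> singular_points (complexify f) = {complex_point (abs_proj P)}
    \<and> cusp (complexify f) (complex_point (abs_proj P))"
proof -
  interpret S: singular_cubic f t P i j k
    using ijk P sing by (intro singular_cubicI) auto
  have feasible: "feasible P w" if "w $ i \<ge> 0" for w
    unfolding feasible_def
  proof
    show "P $ l > 0 \<or> P $ l = 0 \<and> w $ l \<ge> 0" for l using S.three[of l] P that by auto
  qed
  have psd: "S.qf s z \<ge> 0" for s z :: real
  proof -
    have nn: "S.qf s z \<ge> 0" if "z \<ge> 0" for s z :: real
    proof -
      have "tri t P (s *s axis k 1 + z *s axis i 1) (s *s axis k 1 + z *s axis i 1) \<ge> 0"
        by (rule second_order[OF feasible]) (use that ijk in \<open>auto simp: axis_def sing\<close>)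
      then show ?thesis by (simp add: S.qf_tri)
    qed
    show ?thesis
    proof (cases "z \<ge> 0")
      case False
      then show ?thesis using nn[of "- z" "- s"] S.qf_scale[of "- 1" s z] by simp
    qed (rule nn)
  qed
  have A: "S.qf 1 0 > (0 :: real)"
  proof (rule ccontr)
    assume "\<not> ?thesis"
    with psd[of 1 0] have q0: "S.qf 1 0 = (0 :: real)" by simp
    then have "tri t P (axis k 1) (axis k 1) = 0" by (simp add: S.qf_def)
    moreover have "feasible P (axis k 1)" "feasible P (- axis k 1)"
      using ijk by (auto intro!: feasible simp: axis_def)
    ultimately have "tri t (axis k 1) (axis k 1) (axis k 1) = 0"
      using third_order_zero[of P "axis k 1"] sing by blast
    then have "S.kf 1 0 = (0 :: real)" by (simp add: S.kf_def)
    with q0 S.no_real_common_zero[of 1 0] show False by simp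
  qed
  have "\<exists>s z :: real. (s \<noteq> 0 \<or> z \<noteq> 0) \<and> S.qf s z = 0"
  proof (rule ccontr)
    assume no: "\<not> ?thesis"
    have "tri t P (s *s axis k 1 + z *s axis i 1) (s *s axis k 1 + z *s axis i 1) > 0"
      if "s \<noteq> 0 \<or> z \<noteq> 0" for s z
    proof -
      have "S.qf s z \<noteq> 0" using no that by blast
      with psd[of s z] show ?thesis by (simp add: S.qf_tri)
    qed
    with no_acnode_on_edge[OF ijk P sing] show False by blast
  qed
  then obtain s z :: real where sz: "s \<noteq> 0 \<or> z \<noteq> 0" "S.qf s z = 0" by blast
  from A have "tri t P (axis k 1) (axis k 1) \<noteq> 0" by (auto simp: S.qf_def)
  then show ?thesis
    using S.rational_curve_V S.singular_point_unique S.cusp_P[OF A psd sz] by blast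
qed

end

theorem mainTheorem7:
  fixes f :: "(3, real) mpoly"
  assumes "f \<in> extremal P33_plus"
    and "irreducible f"
  shows "rational_curve (V_complex f) \<and>
    (\<exists>P :: (real, 3) proj.
       singular_points (complexify f) = {complex_point P} \<and>
       ((acnode f P \<and> P \<in> P2_plus_interior) \<or>
        (cusp (complexify f) (complex_point P) \<and> (\<exists>i. P \<in> P2_plus_edge i) \<and> P \<notin> vertices)))"
proof -
  have "homogeneous 3 f" using assms(1) by (simp add: extremal_def P33_plus_def)
  then obtain t where "sym3 t" "\<And>v. poly_eval (complexify f) v = ctri t v v v"
    using homogeneous_3_tri by blast
  then interpret extremal_cubic f t using assms by unfold_locales auto
  obtain p where p: "nonneg p" "p \<noteq> 0" and sing: "\<And>w. tri t p p w = 0"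
    using singular_zero_exists by blast
  have pl: "p $ l > 0 \<or> p $ l = 0" for l using p(1) by (auto simp: nonneg_def less_le)
  show ?thesis
  proof (cases "\<exists>i. p $ i = 0")
    case False
    with pl have pos: "p $ l > 0" for l by blast
    define P where "P = (1 / p $ 2) *s p"
    have P: "P $ 2 = 1" "\<And>l. P $ l > 0" using pos by (simp_all add: P_def less_imp_neq[THEN not_sym])
    have "tri t P P w = 0" for w by (simp add: P_def tri_scale sing)
    from interior_case[of 1 2 3, OF _ _ _ P this]
    have "rational_curve (V_complex f)" "singular_points (complexify f) = {complex_point (abs_proj P)}"
      "acnode f (abs_proj P)" by simp_all
    moreover have "abs_proj P \<in> P2_plus_interior" unfolding P2_plus_interior_def using P(2) by blast
    ultimately show ?thesis by blast
  next
    case True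
    then obtain i where i: "p $ i = 0" by blast
    obtain j where j: "p $ j > 0" using p(2) pl by (auto simp: vec_eq_iff)
    have "i \<noteq> j" using i j by auto
    then obtain k where ijk: "i \<noteq> j" "j \<noteq> k" "i \<noteq> k"
    proof -
      have "\<exists>k. j \<noteq> k \<and> i \<noteq> k"
      proof (rule ccontr)
        assume "\<not> ?thesis"
        then have "UNIV \<subseteq> {i, j}" by auto
        from card_mono[OF _ this] show False using \<open>i \<noteq> j\<close> by simp
      qed
      then show thesis using that \<open>i \<noteq> j\<close> by blast
    qed
    define P where "P = (1 / p $ j) *s p"
    have P: "P $ i = 0" "P $ j = 1" using i j by (simp_all add: P_def)
    have singP: "tri t P P w = 0" for w by (simp add: P_def tri_scale sing)
    have "P $ k \<noteq> 0"
    proof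
      assume k: "P $ k = 0"
      have "P = axis j 1"
        unfolding vec_eq_iff
      proof
        show "P $ x = axis j 1 $ x" for x
          using three_indices[OF ijk, of x] ijk P k by (auto simp: axis_def)
      qed
      with vertex_not_singular[OF ijk] singP show False by simp
    qed
    then have Pk: "P $ k > 0" using pl[of k] j by (auto simp: P_def)
    from edge_case[OF ijk P Pk singP] have
      "rational_curve (V_complex f)" "singular_points (complexify f) = {complex_point (abs_proj P)}"
      "cusp (complexify f) (complex_point (abs_proj P))" by simp_all
    moreover have P0: "P \<noteq> 0" using P by auto
    have "P $ l \<ge> 0" for l using p(1) j by (simp add: P_def nonneg_def)
    with P0 P(1) have "abs_proj P \<in> P2_plus_edge i"
      unfolding P2_plus_edge_def P2_plus_def by blast
    moreover have "abs_proj P \<notin> vertices"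
    proof
      assume "abs_proj P \<in> vertices"
      then obtain l where "abs_proj P = abs_proj (axis l 1)" by (auto simp: vertices_def)
      moreover have "axis l 1 \<noteq> (0 :: real ^ 3)" by (simp add: axis_eq_0_iff)
      ultimately obtain c where c: "axis l 1 = c *s P" using abs_proj_eq_iff[OF P0] by blast
      have "c \<noteq> 0" using c \<open>axis l 1 \<noteq> 0\<close> by auto
      then have "(axis l 1 :: real ^ 3) $ j \<noteq> 0" "(axis l 1 :: real ^ 3) $ k \<noteq> 0"
        unfolding c using P Pk by auto
      with ijk show False by (auto simp: axis_def split: if_splits)
    qed
    ultimately show ?thesis by blast
  qed
qed

end
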